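(* Let $D\subset\mathbb{R}^s$ be a convex polyhedral set, let $g:\mathbb{R}^n\to\mathbb{R}^s$ be twice continuously differentiable, let $\Gamma:=\{x\in\mathbb{R}^n: g(x)\in D\}$, let $\bar x\in\Gamma$ and assume that the constraint map $x'\rightrightarrows g(x')-D$ is metrically subregular at $(\bar x,0)$. Let $F(x',\lambda'):=(g(x'),\lambda')-\mathrm{gph}\,N_D$ for $(x',\lambda')\in\mathbb{R}^n\times\mathbb{R}^s$ and \[\Lambda(x,x^* ):=\{\lambda\in N_D(g(x)):\nabla g(x)^T\lambda=x^*\}.\] Then for all $x$ sufficiently near $\bar x$ and all $x^*\in N_\Gamma(x)$ the following hold. For all $u\in\mathbb{R}^n$, \begin{align*} DN_\Gamma(x,x^* )(u)&\subset\bigcup_{\lambda\in\Lambda(x,x^* )}\nabla^2\langle\lambda,g\rangle(x)u+\nabla g(x)^TN_{\mathcal{K}_D(g(x),\lambda)}(\nabla g(x)u)\\ &=\bigcup_{\lambda\in\Lambda(x,x^* )}\nabla^2\langle\lambda,g\rangle(x)u+N_{\mathcal{K}_\Gamma(x,x^* )}(u). \end{align*} The opposite inclusion holds (for a given $u$) if $F$ is metrically subregular at $((x,\lambda),(0,0))$ for every $\lambda\in\Lambda(x,x^* )$ in direction $(u,\eta)$ for every $\eta\in N_{\mathcal{K}_D(g(x),\lambda)}(\nabla g(x)u)$. This is true, in particular, if the following non-degeneracy condition in direction $u$ holds: \[\nabla g(x)^T\mu=0,\ \ \mu\in\mathrm{sp}\,N_{T_D(g(x))}(\nabla g(x)u)\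 \Longrightarrow\ \mu=0.\] Under this non-degeneracy condition in direction $u$, moreover, for all $w^*\in\mathbb{R}^n$ and all $u^*\in DN_\Gamma(x,x^* )(u)$, \[D^*N_\Gamma((x,x^* );(u,u^* ))(w^* )\subset\bigcup_{\lambda\in\Lambda(x,x^* )}\ \bigcup_{\eta\in D\Lambda((x,x^* ),\lambda)(u,u^* )}\nabla^2\langle\lambda,g\rangle(x)w^*+\nabla g(x)^TD^*N_D((g(x),\lambda);(\nabla g(x)u,\eta))(\nabla g(x)w^* ).\]
   Context: For a closed set $\Omega$ and $\bar z\in\Omega$: $T_\Omega(\bar z)=\{w:\exists t_k\downarrow0,\,w_k\to w,\ \bar z+t_kw_k\in\Omega\ \forall k\}$; $\widehat N_\Omega(\bar z)=T_\Omega(\bar z)^\circ$ (negative polar); limiting normal cone $N_\Omega(\bar z)=\{z^*:\exists z_k\to\bar z,\ z_k^*\to z^*,\ z_k^*\in\widehat N_\Omega(z_k)\}$ (the usual normal cone if $\Omega$ is convex); directional limiting normal cone $N_\Omega(\bar z;w)=\{z^*:\exists t_k\downarrow0,\ w_k\to w,\ z_k^*\to z^*,\ z_k^*\in\widehat N_\Omega(\bar z+t_kw_k)\}$. All are empty at points outside $\Omega$. $\mathrm{sp}\,A$ is the linear hull of $A$, with $\mathrm{sp}\,\emptyset=\{0\}$. Critical cone: $\mathcal{K}_\Omega(z,z^* ):=T_\Omega(z)\cap\{w:\langle z^*,w\rangle=0\}$. $\langle\lambda,g\rangle(x)=\lambda^Tg(x)$. A convex polyhedral set is a finite intersection of halfspaces.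 For a set-valued $M$ and $(\bar x,\bar y)\in\mathrm{gph}\,M$: graphical derivative $DM(\bar x,\bar y)(u)=\{v:(u,v)\in T_{\mathrm{gph}\,M}(\bar x,\bar y)\}$; directional limiting coderivative $D^*M((\bar x,\bar y);(u,v))(v^* )=\{u^*:(u^*,-v^* )\in N_{\mathrm{gph}\,M}((\bar x,\bar y);(u,v))\}$. $N_\Gamma$ is regarded as the set-valued map $x'\rightrightarrows N_\Gamma(x')$, and similarly $N_D$. $M$ is metrically subregular at $(\bar x,\bar y)\in\mathrm{gph}\,M$ if there are $\kappa>0$ and a neighbourhood $U$ of $\bar x$ with $\mathrm{dist}(x,M^{-1}(\bar y))\le\kappa\,\mathrm{dist}(\bar y,M(x))$ for all $x\in U$. It is metrically subregular in direction $u$ if there is $\kappa>0$ such that for every sequence $x_k=\bar x+t_ku_k$ with $t_k\downarrow0$, $u_k\to u$ this inequality holds with $x=x_k$ for all sufficiently large $k$. *)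

theory Defs
  imports "HOL-Analysis.Analysis"
begin

section \<open>Tangent and normal cones\<close>

text \<open>All cones are defined to be empty at points outside the set.
  The notation \<open>t\<^sub>k \<down> 0\<close> is read as \<open>t\<^sub>k > 0\<close> and \<open>t\<^sub>k \<longlonglongrightarrow> 0\<close>; monotonicity of
  the sequence is not required, which is immaterial after passing to subsequences.\<close>

definition tangent_cone :: "'a::euclidean_space set \<Rightarrow> 'a \<Rightarrow> 'a set" where
  "tangent_cone \<Omega> z = {w. z \<in> \<Omega> \<and>
     (\<exists>t v. (\<forall>k::nat. t k > (0::real)) \<and> t \<longlonglongrightarrow> 0 \<and> v \<longlonglongrightarrow> w \<and> (\<forall>k. z + t k *\<^sub>R v k \<in> \<Omega>))}"

definition negative_polar :: "'a::euclidean_space set \<Rightarrow> 'a set" where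
  "negative_polar K = {zs. \<forall>w\<in>K. zs \<bullet> w \<le> 0}"

definition regular_normal_cone :: "'a::euclidean_space set \<Rightarrow> 'a \<Rightarrow> 'a set" where
  "regular_normal_cone \<Omega> z = (if z \<in> \<Omega> then negative_polar (tangent_cone \<Omega> z) else {})"

definition limiting_normal_cone :: "'a::euclidean_space set \<Rightarrow> 'a \<Rightarrow> 'a set" where
  "limiting_normal_cone \<Omega> z = {zs. z \<in> \<Omega> \<and>
     (\<exists>y ys. y \<longlonglongrightarrow> z \<and> ys \<longlonglongrightarrow> zs \<and> (\<forall>k::nat. ys k \<in> regular_normal_cone \<Omega> (y k)))}"

definition dir_limiting_normal_cone :: "'a::euclidean_space set \<Rightarrow> 'a \<Rightarrow> 'a \<Rightarrow> 'a set" where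
  "dir_limiting_normal_cone \<Omega> z w = {zs. z \<in> \<Omega> \<and>
     (\<exists>t v ys. (\<forall>k::nat. t k > (0::real)) \<and> t \<longlonglongrightarrow> 0 \<and> v \<longlonglongrightarrow> w \<and> ys \<longlonglongrightarrow> zs \<and>
        (\<forall>k. ys k \<in> regular_normal_cone \<Omega> (z + t k *\<^sub>R v k)))}"

definition critical_cone :: "'a::euclidean_space set \<Rightarrow> 'a \<Rightarrow> 'a \<Rightarrow> 'a set" where
  "critical_cone \<Omega> z zs = tangent_cone \<Omega> z \<inter> {w. zs \<bullet> w = 0}"

section \<open>Set-valued maps\<close>

definition gph :: "('a \<Rightarrow> 'b set) \<Rightarrow> ('a \<times> 'b) set" where
  "gph M = {(x, y). y \<in> M x}"

definition graphical_derivative ::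
    "('a::euclidean_space \<Rightarrow> 'b::euclidean_space set) \<Rightarrow> 'a \<times> 'b \<Rightarrow> 'a \<Rightarrow> 'b set" where
  "graphical_derivative M p u = {v. (u, v) \<in> tangent_cone (gph M) p}"

definition dir_limiting_coderivative ::
    "('a::euclidean_space \<Rightarrow> 'b::euclidean_space set) \<Rightarrow> 'a \<times> 'b \<Rightarrow> 'a \<times> 'b \<Rightarrow> 'b \<Rightarrow> 'a set" where
  "dir_limiting_coderivative M p d vs = {us. (us, - vs) \<in> dir_limiting_normal_cone (gph M) p d}"

text \<open>The inequality \<open>dist(x, M\<inverse>(y)) \<le> \<kappa> dist(y, M(x))\<close>, where the distance to the
  empty set is infinite; \<^const>\<open>infdist\<close> would return \<open>0\<close> when \<open>M x\<close> is empty. The set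
  \<open>M\<inverse>(y)\<close> is nonempty in the two definitions below, because they require \<open>(a, y) \<in> gph M\<close>.\<close>

definition subregularity_estimate ::
    "('a::euclidean_space \<Rightarrow> 'b::euclidean_space set) \<Rightarrow> 'b \<Rightarrow> real \<Rightarrow> 'a \<Rightarrow> bool" where
  "subregularity_estimate M y \<kappa> x \<longleftrightarrow>
     (M x \<noteq> {} \<longrightarrow> infdist x {x'. y \<in> M x'} \<le> \<kappa> * infdist y (M x))"

definition metrically_subregular ::
    "('a::euclidean_space \<Rightarrow> 'b::euclidean_space set) \<Rightarrow> 'a \<Rightarrow> 'b \<Rightarrow> bool" where
  "metrically_subregular M a y \<longleftrightarrow> (a, y) \<in> gph M \<and>
     (\<exists>\<kappa>>0. \<exists>U. open U \<and> a \<in> U \<and> (\<forall>x\<in>U. subregularity_estimate M y \<kappa> x))"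

definition dir_metrically_subregular ::
    "('a::euclidean_space \<Rightarrow> 'b::euclidean_space set) \<Rightarrow> 'a \<Rightarrow> 'b \<Rightarrow> 'a \<Rightarrow> bool" where
  "dir_metrically_subregular M a y u \<longleftrightarrow> (a, y) \<in> gph M \<and>
     (\<exists>\<kappa>>0. \<forall>t v. (\<forall>k::nat. t k > (0::real)) \<longrightarrow> t \<longlonglongrightarrow> 0 \<longrightarrow> v \<longlonglongrightarrow> u \<longrightarrow>
        (\<forall>\<^sub>F k in sequentially. subregularity_estimate M y \<kappa> (a + t k *\<^sub>R v k)))"

section \<open>Second-order derivatives\<close>

definition twice_continuously_differentiable ::
    "('a::euclidean_space \<Rightarrow> 'b::euclidean_space) \<Rightarrow> bool" where
  "twice_continuously_differentiable f \<longleftrightarrow>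
     (\<exists>(f' :: 'a \<Rightarrow> 'a \<Rightarrow>\<^sub>L 'b) (f'' :: 'a \<Rightarrow> 'a \<Rightarrow>\<^sub>L ('a \<Rightarrow>\<^sub>L 'b)).
        (\<forall>x. (f has_derivative blinfun_apply (f' x)) (at x)) \<and>
        (\<forall>x. (f' has_derivative blinfun_apply (f'' x)) (at x)) \<and>
        continuous_on UNIV f'')"

definition gradient :: "(real ^ 'n \<Rightarrow> real) \<Rightarrow> real ^ 'n \<Rightarrow> real ^ 'n" where
  "gradient f x = (\<chi> i. frechet_derivative f (at x) (axis i 1))"

definition hessian :: "(real ^ 'n \<Rightarrow> real) \<Rightarrow> real ^ 'n \<Rightarrow> real ^ 'n ^ 'n" where
  "hessian f x = jacobian (gradient f) (at x)"

end

theory Submission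
  imports Defs
begin

text \<open>
  Write \<open>K\<close> for the critical cone of \<open>D\<close> at \<open>(g x, l)\<close>, \<open>T\<close> for the tangent cone of \<open>D\<close> at
  \<open>g x\<close>, and \<open>v = J x *v u\<close>. Since \<open>D\<close> is cut out by finitely many half-spaces, the graph of its normal
  cone map coincides near each of its points with a translated cone. Two one-sided forms of this carry
  the proof: normals at points approaching \<open>g x\<close> in direction \<open>v\<close> are normals to \<open>T\<close> at \<open>v\<close>
  (\<open>normal_cone_near_direction\<close>), and \<open>l + t \<eta>\<close> is normal at \<open>g x + t v\<close> for \<open>\<eta>\<close> normal to \<open>K\<close> at
  \<open>v\<close> and small \<open>t > 0\<close> (\<open>normal_cone_graph_step\<close>).

  Upper estimate. Metric subregularity of the constraint map provides, at every point near \<open>xbar\<close>,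
  a multiplier of norm at most \<open>\<kappa>\<close> times the norm of the normal vector (\<open>bounded_multiplier_limiting\<close>).
  Along a sequence in the graph of the normal cone map of \<open>\<Gamma>\<close> such multipliers \<open>l k\<close> subconverge to
  some \<open>l\<close>. The quotients \<open>(l k - l) / t k\<close> lie in the normal cone to \<open>K\<close> at \<open>v\<close>. They may be
  unbounded, but their images under the transposed Jacobian converge to \<open>us - H l x *v u\<close>, and a
  linear image of a finitely generated cone is closed (\<open>graphical_derivative_subset\<close>).

  Lower estimate. The point \<open>(x + t u, l + t \<eta>)\<close> misses the graph condition encoded in \<open>F\<close> only by
  \<open>o(t)\<close>, so directional subregularity moves it by \<open>o(t)\<close> to a point where the condition
  holds exactly, and the transposed Jacobian turns that point into an element of the graph of the
  normal cone map of \<open>\<Gamma>\<close> (\<open>graphical_derivative_superset\<close>).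

  Nondegeneracy. Let \<open>S\<close> be the span of the normals to \<open>T\<close> at \<open>v\<close>. Nondegeneracy says that the
  transposed Jacobian is injective on \<open>S\<close>, that is, the Jacobian is onto modulo the orthogonal
  complement of \<open>S\<close>. Near \<open>g x\<close> in direction \<open>v\<close>, moving a point of \<open>D\<close> by \<open>o(t)\<close> within that complement
  neither leaves \<open>D\<close> nor destroys a normal vector. So a nearest point of the graph of the normal
  cone map of \<open>D\<close> needs to be matched only modulo the complement, which a contraction argument
  achieves at proportional cost (\<open>nondegenerate_imp_dir_subregular\<close>).

  Coderivative. Near \<open>x\<close> in direction \<open>u\<close> the transposed Jacobian is still injective on all of \<open>S\<close>, and
  \<open>S\<close> contains every normal of \<open>D\<close> there. Hence nondegeneracy holds at these points in every direction, the
  lower estimate describes enough tangents to identify regular normals to the graph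
  (\<open>regular_normal_graph\<close>), and uniform injectivity bounds all multipliers, so that the formula
  passes to the limit (\<open>dir_limiting_coderivative_subset\<close>).
\<close>

section \<open>Normal cones of convex sets\<close>

text \<open>
  Proofs below move a matrix to its transpose across inner products. The simplifier's normal form
  \<open>l v* A\<close> of \<open>transpose A *v l\<close> would hide the adjoint from this rule.
\<close>
lemma inner_transpose_matrix:
  fixes A :: "real ^ 'n ^ 's"
  shows "(transpose A *v a) \<bullet> w = a \<bullet> (A *v w)"
  by (simp add: transpose_matrix_vector dot_lmul_matrix)

declare transpose_matrix_vector [simp del]

text \<open>
  For convex \<open>P\<close> all differences \<open>p - z\<close> are tangent directions, so the polar of the tangent
  cone is the normal cone of convex analysis.
\<close>
lemma regular_normal_cone_convex:
  assumes "convex P"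
  shows "l \<in> regular_normal_cone P z \<longleftrightarrow> z \<in> P \<and> (\<forall>p\<in>P. l \<bullet> (p - z) \<le> 0)"
proof (intro iffI conjI ballI)
  assume l: "l \<in> regular_normal_cone P z"
  then show z: "z \<in> P" by (auto simp: regular_normal_cone_def split: if_splits)
  fix p assume p: "p \<in> P"
  have "z + (1 / real (Suc k)) *\<^sub>R (p - z) \<in> P" for k
    using convexD_alt[OF assms z p, of "1 / real (Suc k)"] by (simp add: algebra_simps)
  then have "p - z \<in> tangent_cone P z"
    unfolding tangent_cone_def using z LIMSEQ_inverse_real_of_nat
    by (auto intro!: exI[of _ "\<lambda>k. 1 / real (Suc k)"] exI[of _ "\<lambda>k. p - z"] simp: inverse_eq_divide)
  then show "l \<bullet> (p - z) \<le> 0"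
    using l by (auto simp: regular_normal_cone_def negative_polar_def split: if_splits)
next
  assume l: "z \<in> P \<and> (\<forall>p\<in>P. l \<bullet> (p - z) \<le> 0)"
  have "l \<bullet> w \<le> 0" if "w \<in> tangent_cone P z" for w
  proof -
    obtain t v where tv: "\<And>k::nat. t k > (0::real)" "v \<longlonglongrightarrow> w" "\<And>k. z + t k *\<^sub>R v k \<in> P"
      using \<open>w \<in> tangent_cone P z\<close> unfolding tangent_cone_def by blast
    have "l \<bullet> v k \<le> 0" for k
    proof -
      have "l \<bullet> ((z + t k *\<^sub>R v k) - z) \<le> 0" using l tv(3) by blast
      then show ?thesis using tv(1)[of k] by (simp add: mult_le_0_iff)
    qed
    then show ?thesis
      by (intro LIMSEQ_le_const2[OF tendsto_inner[OF tendsto_const tv(2)]]) auto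
  qed
  then show "l \<in> regular_normal_cone P z"
    using l by (simp add: regular_normal_cone_def negative_polar_def)
qed

lemma regular_subset_limiting:
  "regular_normal_cone P z \<subseteq> limiting_normal_cone P z"
proof
  fix l assume "l \<in> regular_normal_cone P z"
  then show "l \<in> limiting_normal_cone P z"
    unfolding limiting_normal_cone_def mem_Collect_eq
    by (intro conjI exI[of _ "\<lambda>k. z"] exI[of _ "\<lambda>k. l"])
       (auto simp: regular_normal_cone_def split: if_splits)
qed

text \<open>
  The inequalities that define a normal vector survive limits in \<open>z\<close> and in \<open>l\<close>, so for convex sets
  the limiting construction adds nothing.
\<close>
lemma limiting_normal_cone_convex:
  assumes "convex P"
  shows "l \<in> limiting_normal_cone P z \<longleftrightarrow> z \<in> P \<and> (\<forall>p\<in>P. l \<bullet> (p - z) \<le> 0)"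
proof
  assume "l \<in> limiting_normal_cone P z"
  then obtain y ys where z: "z \<in> P" and lim: "y \<longlonglongrightarrow> z" "ys \<longlonglongrightarrow> l"
    and reg: "\<And>k::nat. ys k \<in> regular_normal_cone P (y k)"
    unfolding limiting_normal_cone_def by blast
  have "l \<bullet> (p - z) \<le> 0" if "p \<in> P" for p
  proof -
    have "ys k \<bullet> (p - y k) \<le> 0" for k
      using reg that by (simp add: regular_normal_cone_convex[OF assms])
    then show ?thesis
      by (intro LIMSEQ_le_const2[OF tendsto_inner[OF lim(2) tendsto_diff[OF tendsto_const lim(1)]]]) auto
  qed
  with z show "z \<in> P \<and> (\<forall>p\<in>P. l \<bullet> (p - z) \<le> 0)" by blast
next
  assume "z \<in> P \<and> (\<forall>p\<in>P. l \<bullet> (p - z) \<le> 0)"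
  then show "l \<in> limiting_normal_cone P z"
    using regular_subset_limiting regular_normal_cone_convex[OF assms] by blast
qed

lemma limiting_normal_cone_of_convex_cone:
  assumes "convex K" "conic K"
  shows "l \<in> limiting_normal_cone K v \<longleftrightarrow> v \<in> K \<and> l \<bullet> v = 0 \<and> (\<forall>w\<in>K. l \<bullet> w \<le> 0)"
proof
  assume "l \<in> limiting_normal_cone K v"
  then have v: "v \<in> K" and l: "\<And>w. w \<in> K \<Longrightarrow> l \<bullet> (w - v) \<le> 0"
    by (auto simp: limiting_normal_cone_convex[OF assms(1)])
  have "2 *\<^sub>R v \<in> K" "0 *\<^sub>R v \<in> K" by (rule conicD[OF assms(2) v]; simp)+
  then have "l \<bullet> v \<le> 0" "l \<bullet> v \<ge> 0" using l[of "2 *\<^sub>R v"] l[of "0 *\<^sub>R v"]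
    by (auto simp: scaleR_2 inner_right_distrib)
  then have lv: "l \<bullet> v = 0" by simp
  show "v \<in> K \<and> l \<bullet> v = 0 \<and> (\<forall>w\<in>K. l \<bullet> w \<le> 0)"
    using v lv l by (auto simp: inner_diff_right)
next
  assume "v \<in> K \<and> l \<bullet> v = 0 \<and> (\<forall>w\<in>K. l \<bullet> w \<le> 0)"
  then show "l \<in> limiting_normal_cone K v"
    by (auto simp: limiting_normal_cone_convex[OF assms(1)] inner_diff_right)
qed

lemma closed_gph_limiting_normal_cone:
  assumes "convex P" "closed P"
  shows "closed (gph (limiting_normal_cone P))"
proof -
  have "gph (limiting_normal_cone P) = (P \<times> UNIV) \<inter> (\<Inter>p\<in>P. {q. snd q \<bullet> (p - fst q) \<le> 0})"
    by (auto simp: gph_def limiting_normal_cone_convex[OF assms(1)])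
  then show ?thesis
    by (simp only:) (intro closed_Int closed_Times assms(2) closed_UNIV closed_INT ballI
        closed_Collect_le continuous_intros)
qed

section \<open>Polyhedra as finite intersections of half-spaces\<close>

text \<open>
  All polyhedral arguments use one explicit system of inequalities \<open>a \<bullet> z \<le> b\<close>, encoded as a finite set of
  pairs. Zero vectors \<open>a\<close> and repeated constraints are permitted, so that such a system can be pulled
  back along an arbitrary linear map.
\<close>
definition halfspaces :: "('a::euclidean_space \<times> real) set \<Rightarrow> 'a set" where
  "halfspaces C = {z. \<forall>(a, b)\<in>C. a \<bullet> z \<le> b}"

definition active :: "('a::euclidean_space \<times> real) set \<Rightarrow> 'a \<Rightarrow> 'a set" where
  "active C z = {a. (a, a \<bullet> z) \<in> C}"

lemma polyhedron_halfspaces: "finite C \<Longrightarrow> polyhedron (halfspaces C)"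
proof -
  assume C: "finite C"
  have "halfspaces C = \<Inter> ((\<lambda>(a, b). {z. a \<bullet> z \<le> b}) ` C)"
    by (auto simp: halfspaces_def)
  also have "polyhedron \<dots>"
    by (rule polyhedron_Inter) (use C in \<open>auto simp: polyhedron_halfspace_le\<close>)
  finally show ?thesis .
qed

lemma polyhedron_imp_halfspaces:
  assumes "polyhedron P"
  obtains C where "finite C" "P = halfspaces C"
proof -
  obtain F where F: "finite F" "P = \<Inter> F" "\<forall>h\<in>F. \<exists>a b. a \<noteq> 0 \<and> h = {x. a \<bullet> x \<le> b}"
    using assms unfolding polyhedron_def by metis
  then obtain a b where ab: "\<And>h. h \<in> F \<Longrightarrow> h = {x. a h \<bullet> x \<le> b h}" by metis
  have "P = halfspaces ((\<lambda>h. (a h, b h)) ` F)"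
    unfolding halfspaces_def F(2) using ab by auto
  then show ?thesis using that F(1) by blast
qed

lemma finite_active: "finite C \<Longrightarrow> finite (active C z)"
proof -
  assume "finite C"
  moreover have "active C z \<subseteq> fst ` C" by (force simp: active_def)
  ultimately show ?thesis by (meson finite_imageI finite_subset)
qed

lemma halfspaces_eventually_step:
  assumes "finite C" "z \<in> halfspaces C" "\<forall>a\<in>active C z. a \<bullet> w \<le> 0"
  shows "\<forall>\<^sub>F t in at_right 0. z + t *\<^sub>R w \<in> halfspaces C"
proof -
  have "\<forall>\<^sub>F t in at_right 0. a \<bullet> (z + t *\<^sub>R w) \<le> b" if ab: "(a, b) \<in> C" for a b
  proof (cases "a \<bullet> z = b")
    case True
    then have "a \<bullet> w \<le> 0" using assms(3) ab by (auto simp: active_def)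
    moreover have "\<forall>\<^sub>F t in at_right (0::real). t > 0" by (rule eventually_at_right_less)
    ultimately show ?thesis
      using True by (elim eventually_mono) (auto simp: inner_right_distrib mult_le_0_iff)
  next
    case False
    then have lt: "a \<bullet> z < b" using assms(2) ab by (force simp: halfspaces_def)
    have "((\<lambda>t. a \<bullet> (z + t *\<^sub>R w)) \<longlongrightarrow> a \<bullet> (z + 0 *\<^sub>R w)) (at_right 0)"
      by (intro tendsto_intros)
    then show ?thesis
      using lt by (auto dest!: order_tendstoD(2)[where a = b] elim!: eventually_mono)
  qed
  then have "\<forall>\<^sub>F t in at_right 0. \<forall>p\<in>C. (case p of (a, b) \<Rightarrow> a \<bullet> (z + t *\<^sub>R w) \<le> b)"
    by (intro eventually_ball_finite assms(1)) auto
  then show ?thesis by (simp add: halfspaces_def)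
qed

lemma filterlim_at_right_zero_seq:
  assumes "\<And>k::nat. t k > (0::real)" "t \<longlonglongrightarrow> 0"
  shows "filterlim t (at_right 0) sequentially"
  using assms by (auto simp: filterlim_at intro!: always_eventually less_imp_neq[THEN not_sym])

lemma inverse_Suc_at_right: "filterlim (\<lambda>k. 1 / real (Suc k)) (at_right 0) sequentially"
  using LIMSEQ_inverse_real_of_nat by (intro filterlim_at_right_zero_seq) (auto simp: inverse_eq_divide)

lemma tangent_cone_intro_at_right:
  assumes "\<forall>\<^sub>F t in at_right 0. z + t *\<^sub>R v t \<in> P" "(v \<longlongrightarrow> w) (at_right (0::real))" "z \<in> P"
  shows "w \<in> tangent_cone P z"
proof -
  let ?s = "\<lambda>k. 1 / real (Suc k)"
  have "\<forall>\<^sub>F k in sequentially. z + ?s k *\<^sub>R v (?s k) \<in> P"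
    using eventually_compose_filterlim[OF assms(1) inverse_Suc_at_right] .
  then obtain N where N: "\<And>k. k \<ge> N \<Longrightarrow> z + ?s k *\<^sub>R v (?s k) \<in> P"
    by (auto simp: eventually_sequentially)
  have "(\<lambda>k. v (?s k)) \<longlonglongrightarrow> w" using filterlim_compose[OF assms(2) inverse_Suc_at_right] .
  moreover have "?s \<longlonglongrightarrow> 0" using LIMSEQ_inverse_real_of_nat by (simp add: inverse_eq_divide)
  ultimately show ?thesis
    unfolding tangent_cone_def using assms(3) N
    by (auto intro!: exI[of _ "\<lambda>k. ?s (k + N)"] exI[of _ "\<lambda>k. v (?s (k + N))"]
        LIMSEQ_ignore_initial_segment simp del: of_nat_Suc)
qed

lemma tangent_cone_halfspaces:
  assumes "finite C" "z \<in> halfspaces C"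
  shows "tangent_cone (halfspaces C) z = {w. \<forall>a\<in>active C z. a \<bullet> w \<le> 0}"
proof (intro set_eqI iffI)
  fix w assume "w \<in> tangent_cone (halfspaces C) z"
  then obtain t v where tv: "\<And>k::nat. t k > (0::real)" "v \<longlonglongrightarrow> w" "\<And>k. z + t k *\<^sub>R v k \<in> halfspaces C"
    unfolding tangent_cone_def by blast
  have "a \<bullet> w \<le> 0" if a: "a \<in> active C z" for a
  proof -
    have "a \<bullet> v k \<le> 0" for k
    proof -
      have "a \<bullet> (z + t k *\<^sub>R v k) \<le> a \<bullet> z" using a tv(3)[of k] by (auto simp: halfspaces_def active_def)
      then show ?thesis using tv(1)[of k] by (simp add: inner_right_distrib mult_le_0_iff)
    qed
    then show ?thesis
      by (intro LIMSEQ_le_const2[OF tendsto_inner[OF tendsto_const tv(2)]]) auto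
  qed
  then show "w \<in> {w. \<forall>a\<in>active C z. a \<bullet> w \<le> 0}" by blast
next
  fix w assume "w \<in> {w. \<forall>a\<in>active C z. a \<bullet> w \<le> 0}"
  then have "\<forall>\<^sub>F t in at_right 0. z + t *\<^sub>R w \<in> halfspaces C"
    by (intro halfspaces_eventually_step assms) auto
  then show "w \<in> tangent_cone (halfspaces C) z"
    by (rule tangent_cone_intro_at_right) (auto simp: assms)
qed

text \<open>
  Farkas' lemma: a finitely generated cone is closed, so a vector outside it can be strictly separated.
\<close>
lemma farkas:
  fixes S :: "'a::euclidean_space set"
  assumes "finite S"
  shows "(\<forall>w. (\<forall>s\<in>S. s \<bullet> w \<le> 0) \<longrightarrow> l \<bullet> w \<le> 0) \<longleftrightarrow> l \<in> convex_cone hull S"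
proof
  assume H: "\<forall>w. (\<forall>s\<in>S. s \<bullet> w \<le> 0) \<longrightarrow> l \<bullet> w \<le> 0"
  show "l \<in> convex_cone hull S"
  proof (rule ccontr)
    assume "l \<notin> convex_cone hull S"
    then obtain w b where wb: "w \<bullet> l < b" "\<And>x. x \<in> convex_cone hull S \<Longrightarrow> w \<bullet> x > b"
      using separating_hyperplane_closed_point[of "convex_cone hull S" l]
        convex_convex_cone_hull closed_convex_cone_hull[OF assms] by blast
    have b0: "b < 0" using wb(2)[OF convex_cone_hull_contains_0] by simp
    have "w \<bullet> s \<ge> 0" if s: "s \<in> S" for s
    proof (rule ccontr)
      assume neg: "\<not> w \<bullet> s \<ge> 0"
      \<comment> \<open>This multiple of \<open>s\<close> has inner product exactly \<open>b\<close> with \<open>w\<close>.\<close>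
      have "(b / (w \<bullet> s)) *\<^sub>R s \<in> convex_cone hull S"
        using neg b0 s by (intro convex_cone_hull_mul hull_inc) (auto simp: divide_nonpos_neg)
      from wb(2)[OF this] show False using neg by simp
    qed
    then have "\<forall>s\<in>S. s \<bullet> (- w) \<le> 0" by (simp add: inner_commute)
    then have "l \<bullet> (- w) \<le> 0" using H by blast
    then show False using wb(1) b0 by (simp add: inner_commute)
  qed
next
  assume l: "l \<in> convex_cone hull S"
  show "\<forall>w. (\<forall>s\<in>S. s \<bullet> w \<le> 0) \<longrightarrow> l \<bullet> w \<le> 0"
  proof (intro allI impI)
    fix w assume "\<forall>s\<in>S. s \<bullet> w \<le> 0"
    then have "S \<subseteq> {s. s \<bullet> w \<le> 0}" by blast
    moreover have "convex_cone {s. s \<bullet> w \<le> 0}"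
      by (auto simp: convex_cone_iff inner_left_distrib mult_nonneg_nonpos)
    ultimately have "convex_cone hull S \<subseteq> {s. s \<bullet> w \<le> 0}" by (rule hull_minimal)
    with l show "l \<bullet> w \<le> 0" by blast
  qed
qed

lemma limiting_normal_cone_halfspaces:
  assumes "finite C"
  shows "limiting_normal_cone (halfspaces C) z =
    (if z \<in> halfspaces C then convex_cone hull (active C z) else {})"
proof (cases "z \<in> halfspaces C")
  case True
  have cvx: "convex (halfspaces C)" using polyhedron_halfspaces[OF assms] by (rule polyhedron_imp_convex)
  have "l \<in> limiting_normal_cone (halfspaces C) z \<longleftrightarrow> l \<in> convex_cone hull (active C z)" for l
  proof -
    have "l \<in> limiting_normal_cone (halfspaces C) z \<longleftrightarrow> l \<in> regular_normal_cone (halfspaces C) z"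
      by (simp add: limiting_normal_cone_convex[OF cvx] regular_normal_cone_convex[OF cvx])
    also have "\<dots> \<longleftrightarrow> (\<forall>w. (\<forall>a\<in>active C z. a \<bullet> w \<le> 0) \<longrightarrow> l \<bullet> w \<le> 0)"
      using True by (simp add: regular_normal_cone_def tangent_cone_halfspaces[OF assms] negative_polar_def)
    finally show ?thesis using farkas[OF finite_active[OF assms]] by blast
  qed
  then show ?thesis using True by auto
next
  case False
  then show ?thesis by (auto simp: limiting_normal_cone_def)
qed

text \<open>
  The half-spaces of the preimage have the normals \<open>A\<^sup>T a\<close>, and the active constraints
  correspond. Both normal cones are generated by their active constraints, and generating a cone
  commutes with linear images.
\<close>
lemma limiting_normal_cone_linear_preimage:
  fixes A :: "real ^ 'n ^ 's"
  assumes "polyhedron P"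
  shows "limiting_normal_cone {u. A *v u \<in> P} u = (*v) (transpose A) ` limiting_normal_cone P (A *v u)"
proof -
  obtain C where C: "finite C" "P = halfspaces C" using polyhedron_imp_halfspaces[OF assms] .
  define C' where "C' = (\<lambda>(a, b). (transpose A *v a, b)) ` C"
  have eq: "{u. A *v u \<in> P} = halfspaces C'"
    by (simp add: C C'_def halfspaces_def case_prod_unfold inner_transpose_matrix)
  have act: "active C' u = (*v) (transpose A) ` active C (A *v u)"
    by (auto simp: active_def C'_def inner_transpose_matrix image_def Bex_def)
  have "finite C'" using C by (simp add: C'_def)
  then show ?thesis
    using eq unfolding C(2)
    by (auto simp: limiting_normal_cone_halfspaces C(1) act convex_cone_hull_linear_image)
qed

lemma closed_linear_image_normal_cone:
  fixes A :: "real ^ 'n ^ 's"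
  assumes "polyhedron P"
  shows "closed ((*v) (transpose A) ` limiting_normal_cone P z)"
proof -
  obtain C where C: "finite C" "P = halfspaces C" using polyhedron_imp_halfspaces[OF assms] .
  have "closed ((*v) (transpose A) ` (convex_cone hull (active C z)))"
    by (subst convex_cone_hull_linear_image[symmetric])
       (auto intro!: closed_convex_cone_hull finite_imageI finite_active C)
  then show ?thesis by (simp add: C limiting_normal_cone_halfspaces)
qed

section \<open>The normal cone map of a polyhedron near a point of its graph\<close>

lemma tangent_cone_as_halfspaces:
  assumes "finite C" "z \<in> halfspaces C"
  shows "tangent_cone (halfspaces C) z = halfspaces ((\<lambda>a. (a, 0)) ` active C z)"
  unfolding tangent_cone_halfspaces[OF assms] by (auto simp: halfspaces_def)

lemma
  assumes "polyhedron D" "y \<in> D"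
  shows polyhedron_tangent_cone: "polyhedron (tangent_cone D y)"
    and conic_tangent_cone: "conic (tangent_cone D y)"
    and tangent_cone_feasible:
      "\<And>w. w \<in> tangent_cone D y \<Longrightarrow> \<forall>\<^sub>F t in at_right 0. y + t *\<^sub>R w \<in> D"
proof -
  obtain C where C: "finite C" "D = halfspaces C" using polyhedron_imp_halfspaces[OF assms(1)] .
  note T = tangent_cone_as_halfspaces[OF C(1) assms(2)[unfolded C(2)]]
  show "polyhedron (tangent_cone D y)"
    unfolding C(2) T by (intro polyhedron_halfspaces finite_imageI finite_active C(1))
  show "conic (tangent_cone D y)"
    unfolding C(2) T by (auto simp: conic_def halfspaces_def mult_nonneg_nonpos)
  show "\<forall>\<^sub>F t in at_right 0. y + t *\<^sub>R w \<in> D" if "w \<in> tangent_cone D y" for w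
    using that halfspaces_eventually_step[OF C(1) assms(2)[unfolded C(2)]]
    unfolding C(2) T by (simp add: halfspaces_def)
qed

lemma tangent_coneI_feasible:
  assumes "convex D" "y \<in> D" "d \<in> D"
  shows "d - y \<in> tangent_cone D y"
proof (rule tangent_cone_intro_at_right)
  show "\<forall>\<^sub>F t in at_right 0. y + t *\<^sub>R (d - y) \<in> D"
    unfolding eventually_at_right_field
  proof (intro exI[of _ 1] conjI allI impI)
    fix t :: real assume "0 < t" "t < 1"
    then show "y + t *\<^sub>R (d - y) \<in> D"
      using convexD_alt[OF assms, of t] by (simp add: algebra_simps)
  qed simp
qed (auto simp: assms)

lemma limiting_normal_cone_polyhedron_polar:
  assumes "polyhedron D" "y \<in> D"
  shows "l \<in> limiting_normal_cone D y \<longleftrightarrow> (\<forall>w\<in>tangent_cone D y. l \<bullet> w \<le> 0)"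
proof -
  have cvx: "convex D" using assms(1) by (rule polyhedron_imp_convex)
  have "l \<in> limiting_normal_cone D y \<longleftrightarrow> l \<in> regular_normal_cone D y"
    by (simp add: limiting_normal_cone_convex[OF cvx] regular_normal_cone_convex[OF cvx])
  then show ?thesis using assms(2) by (simp add: regular_normal_cone_def negative_polar_def)
qed

lemma limiting_normal_cone_tangent:
  assumes "polyhedron D" "y \<in> D"
  shows "l \<in> limiting_normal_cone (tangent_cone D y) v \<longleftrightarrow>
     v \<in> tangent_cone D y \<and> l \<bullet> v = 0 \<and> l \<in> limiting_normal_cone D y"
  by (simp add: limiting_normal_cone_of_convex_cone conic_tangent_cone polyhedron_imp_convex
      polyhedron_tangent_cone limiting_normal_cone_polyhedron_polar assms)

lemma
  assumes "polyhedron D" "y \<in> D"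
  shows polyhedron_critical_cone: "polyhedron (critical_cone D y l)"
    and conic_critical_cone: "conic (critical_cone D y l)"
proof -
  show "polyhedron (critical_cone D y l)"
    unfolding critical_cone_def using polyhedron_tangent_cone[OF assms] polyhedron_hyperplane by blast
  show "conic (critical_cone D y l)"
    using conic_tangent_cone[OF assms] by (auto simp: conic_def critical_cone_def)
qed

lemma limiting_normal_cone_critical:
  assumes "polyhedron D" "y \<in> D"
  shows "\<eta> \<in> limiting_normal_cone (critical_cone D y l) v \<longleftrightarrow>
     v \<in> critical_cone D y l \<and> \<eta> \<bullet> v = 0 \<and> (\<forall>w\<in>critical_cone D y l. \<eta> \<bullet> w \<le> 0)"
  by (simp add: limiting_normal_cone_of_convex_cone conic_critical_cone polyhedron_imp_convex
      polyhedron_critical_cone assms)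

text \<open>
  Along points approaching \<open>y\<close> in direction \<open>v0\<close>, the only constraints that a perturbation of size
  \<open>o(t)\<close> can endanger are those active at \<open>y\<close> with \<open>a \<bullet> v0 = 0\<close>. Their normals are normal to the tangent
  cone at \<open>v0\<close>, so a perturbation orthogonal to the latter leaves them unchanged.
\<close>
lemma polyhedron_feasible_perturbation:
  assumes D: "polyhedron D" "y \<in> D"
    and t: "\<And>k::nat. t k > (0::real)" "t \<longlonglongrightarrow> 0" and v: "v \<longlonglongrightarrow> v0" "\<And>k. y + t k *\<^sub>R v k \<in> D"
    and w: "w \<longlonglongrightarrow> 0" "\<And>k l. l \<in> limiting_normal_cone (tangent_cone D y) v0 \<Longrightarrow> l \<bullet> w k = 0"
  shows "\<forall>\<^sub>F k in sequentially. y + t k *\<^sub>R (v k + w k) \<in> D"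
proof -
  obtain C where C: "finite C" "D = halfspaces C" using polyhedron_imp_halfspaces[OF D(1)] .
  note T = tangent_cone_halfspaces[OF C(1) D(2)[unfolded C(2)]]
  have v0: "v0 \<in> tangent_cone D y" unfolding tangent_cone_def using assms by blast
  have "\<forall>\<^sub>F k in sequentially. a \<bullet> (y + t k *\<^sub>R (v k + w k)) \<le> b" if ab: "(a, b) \<in> C" for a b
  proof -
    have le: "a \<bullet> (y + t k *\<^sub>R v k) \<le> b" for k using v(2)[of k] ab by (auto simp: C halfspaces_def)
    have "a \<bullet> y \<le> b" using D(2) ab by (auto simp: C halfspaces_def)
    then consider "a \<bullet> y < b" | "a \<bullet> y = b" "a \<bullet> v0 < 0" | "a \<bullet> y = b" "a \<bullet> v0 \<ge> 0" by linarith
    then show ?thesis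
    proof cases
      case 1
      have "(\<lambda>k. a \<bullet> (y + t k *\<^sub>R (v k + w k))) \<longlonglongrightarrow> a \<bullet> (y + 0 *\<^sub>R (v0 + 0))"
        by (intro tendsto_intros t v w)
      then show ?thesis using 1 by (auto dest!: order_tendstoD(2)[where a = b] elim!: eventually_mono)
    next
      case 2
      have "(\<lambda>k. a \<bullet> (v k + w k)) \<longlonglongrightarrow> a \<bullet> (v0 + 0)"
        by (intro tendsto_intros v w)
      then have "\<forall>\<^sub>F k in sequentially. a \<bullet> (v k + w k) < 0"
        using 2 by (auto dest!: order_tendstoD(2)[where a = 0])
      then show ?thesis
      proof (rule eventually_mono)
        fix k assume "a \<bullet> (v k + w k) < 0"
        then have "t k * (a \<bullet> (v k + w k)) \<le> 0" using t(1)[of k] by (simp add: mult_le_0_iff)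
        then show "a \<bullet> (y + t k *\<^sub>R (v k + w k)) \<le> b" using 2(1) by (simp add: inner_right_distrib)
      qed
    next
      case 3
      have act: "a \<in> active C y" using 3 ab by (auto simp: active_def)
      then have "a \<bullet> v0 = 0" using v0 3 by (force simp: C T)
      moreover have "a \<in> limiting_normal_cone D y"
        using act D(2) by (auto simp: C limiting_normal_cone_halfspaces intro: hull_inc)
      ultimately have "a \<in> limiting_normal_cone (tangent_cone D y) v0"
        using v0 by (simp add: limiting_normal_cone_tangent[OF D])
      from w(2)[OF this] show ?thesis using le by (simp add: algebra_simps inner_simps)
    qed
  qed
  then have "\<forall>\<^sub>F k in sequentially. \<forall>p\<in>C. (case p of (a, b) \<Rightarrow> a \<bullet> (y + t k *\<^sub>R (v k + w k)) \<le> b)"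
    by (intro eventually_ball_finite C(1)) auto
  then show ?thesis by (simp add: C halfspaces_def)
qed

text \<open>
  A constraint active at \<open>y + t v\<close> with small \<open>t\<close> and \<open>v\<close> close to \<open>v0\<close> is active at \<open>y\<close> and
  satisfies \<open>a \<bullet> v0 = 0\<close>. As there are finitely many constraints, this holds for all of them at once,
  and the active normals generate the normal cone.
\<close>
lemma normal_cone_near_direction:
  assumes D: "polyhedron D" "y \<in> D"
    and t: "\<And>k::nat. t k > (0::real)" "t \<longlonglongrightarrow> 0" and v: "v \<longlonglongrightarrow> v0" "\<And>k. y + t k *\<^sub>R v k \<in> D"
  shows "\<forall>\<^sub>F k in sequentially. limiting_normal_cone D (y + t k *\<^sub>R v k)
           \<subseteq> limiting_normal_cone (tangent_cone D y) v0"
proof -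
  obtain C where C: "finite C" "D = halfspaces C" using polyhedron_imp_halfspaces[OF D(1)] .
  note T = tangent_cone_halfspaces[OF C(1) D(2)[unfolded C(2)]]
  have v0: "v0 \<in> tangent_cone D y" unfolding tangent_cone_def using assms by blast
  have "\<forall>\<^sub>F k in sequentially. a \<bullet> (y + t k *\<^sub>R v k) = b \<longrightarrow> a \<bullet> y = b \<and> a \<bullet> v0 = 0"
    if ab: "(a, b) \<in> C" for a b
  proof -
    have le: "a \<bullet> y \<le> b" using D(2) ab by (auto simp: C halfspaces_def)
    have "a \<bullet> v0 \<le> 0" if "a \<bullet> y = b"
      using that v0 ab by (auto simp: C T active_def)
    with le consider "a \<bullet> y < b" | "a \<bullet> y = b" "a \<bullet> v0 < 0" | "a \<bullet> y = b" "a \<bullet> v0 = 0" by fastforce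
    then show ?thesis
    proof cases
      case 1
      have "(\<lambda>k. a \<bullet> (y + t k *\<^sub>R v k)) \<longlonglongrightarrow> a \<bullet> (y + 0 *\<^sub>R v0)"
        by (intro tendsto_intros t v)
      then show ?thesis using 1 by (auto dest!: order_tendstoD(2)[where a = b] elim!: eventually_mono)
    next
      case 2
      have "(\<lambda>k. a \<bullet> v k) \<longlonglongrightarrow> a \<bullet> v0"
        by (intro tendsto_intros v)
      then have "\<forall>\<^sub>F k in sequentially. a \<bullet> v k < 0"
        using 2 by (auto dest!: order_tendstoD(2)[where a = 0])
      then show ?thesis
        using 2 t(1) by (elim eventually_mono) (auto simp: inner_right_distrib less_imp_neq[THEN not_sym])
    qed auto
  qed
  then have ev: "\<forall>\<^sub>F k in sequentially. \<forall>p\<in>C. (case p of (a, b) \<Rightarrow>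
      a \<bullet> (y + t k *\<^sub>R v k) = b \<longrightarrow> a \<bullet> y = b \<and> a \<bullet> v0 = 0)"
    by (intro eventually_ball_finite C(1)) auto
  obtain C' where C': "finite C'" "tangent_cone D y = halfspaces C'"
    using polyhedron_imp_halfspaces[OF polyhedron_tangent_cone[OF D]] .
  have cone: "convex_cone (limiting_normal_cone (tangent_cone D y) v0)"
    using v0 C' by (simp add: limiting_normal_cone_halfspaces convex_cone_convex_cone_hull)
  from ev show ?thesis
  proof (rule eventually_mono)
    fix k
    assume k: "\<forall>p\<in>C. (case p of (a, b) \<Rightarrow> a \<bullet> (y + t k *\<^sub>R v k) = b \<longrightarrow> a \<bullet> y = b \<and> a \<bullet> v0 = 0)"
    have "active C (y + t k *\<^sub>R v k) \<subseteq> limiting_normal_cone (tangent_cone D y) v0"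
    proof
      fix a assume "a \<in> active C (y + t k *\<^sub>R v k)"
      then have "a \<in> active C y" "a \<bullet> v0 = 0" using k by (auto simp: active_def)
      moreover from this have "a \<in> limiting_normal_cone D y"
        using D(2) by (auto simp: C limiting_normal_cone_halfspaces intro: hull_inc)
      ultimately show "a \<in> limiting_normal_cone (tangent_cone D y) v0"
        using v0 by (simp add: limiting_normal_cone_tangent[OF D])
    qed
    then show "limiting_normal_cone D (y + t k *\<^sub>R v k) \<subseteq> limiting_normal_cone (tangent_cone D y) v0"
      using hull_minimal[where S = convex_cone, OF _ cone] by (auto simp: C limiting_normal_cone_halfspaces)
  qed
qed

text \<open>
  A normal \<open>\<eta>\<close> to the critical cone is \<open>\<mu> - c l\<close> with \<open>\<mu>\<close> normal to \<open>D\<close> and \<open>c \<ge> 0\<close>, by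
  Farkas' lemma applied to the active constraints and \<open>- l\<close>. For \<open>t c < 1\<close> the vector \<open>l + t \<eta>\<close> is
  therefore a nonnegative combination of normals of \<open>D\<close> at \<open>y\<close>, and it stays normal at
  \<open>y + t v\<close> because it is orthogonal to \<open>v\<close>.
\<close>
lemma normal_cone_graph_step:
  assumes D: "polyhedron D" "y \<in> D" and l: "l \<in> limiting_normal_cone D y"
    and eta: "\<eta> \<in> limiting_normal_cone (critical_cone D y l) v"
  shows "\<forall>\<^sub>F t in at_right 0. l + t *\<^sub>R \<eta> \<in> limiting_normal_cone D (y + t *\<^sub>R v)"
proof -
  obtain C where C: "finite C" "D = halfspaces C" using polyhedron_imp_halfspaces[OF D(1)] .
  note T = tangent_cone_halfspaces[OF C(1) D(2)[unfolded C(2)]]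
  let ?S = "active C y"
  have v: "v \<in> tangent_cone D y" "l \<bullet> v = 0" "\<eta> \<bullet> v = 0"
    and le: "\<And>w. w \<in> critical_cone D y l \<Longrightarrow> \<eta> \<bullet> w \<le> 0"
    using eta[unfolded limiting_normal_cone_critical[OF D]] by (auto simp: critical_cone_def)
  have hull: "limiting_normal_cone D y = convex_cone hull ?S"
    using D(2) by (simp add: C limiting_normal_cone_halfspaces)
  have "\<eta> \<in> convex_cone hull (?S \<union> {- l})"
  proof (subst farkas[symmetric]; (intro allI impI)?)
    fix w assume w: "\<forall>s\<in>?S \<union> {- l}. s \<bullet> w \<le> 0"
    then have wT: "w \<in> tangent_cone D y" by (simp add: C T)
    moreover have "l \<bullet> w \<le> 0" using l wT limiting_normal_cone_polyhedron_polar[OF D] by blast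
    ultimately show "\<eta> \<bullet> w \<le> 0" using le w by (auto simp: critical_cone_def)
  qed (simp add: finite_active C)
  then obtain \<mu> \<nu> where mu: "\<mu> \<in> convex_cone hull ?S" "\<nu> \<in> convex_cone hull {- l}" "\<eta> = \<mu> + \<nu>"
    unfolding convex_cone_hull_Un by blast
  then obtain c where c: "\<nu> = c *\<^sub>R (- l)" "c \<ge> 0"
    by (auto simp: convex_cone_hull_convex_hull_nonempty)
  have "((\<lambda>t. t * c) \<longlongrightarrow> 0 * c) (at_right 0)" by (intro tendsto_intros)
  then have "\<forall>\<^sub>F t in at_right 0. t * c < 1" by (rule order_tendstoD(2)) simp
  moreover have "\<forall>\<^sub>F t in at_right (0::real). t > 0" by (rule eventually_at_right_less)
  ultimately show ?thesis using tangent_cone_feasible[OF D v(1)]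
  proof eventually_elim
    case (elim t)
    have "l + t *\<^sub>R \<eta> = (1 - t * c) *\<^sub>R l + t *\<^sub>R \<mu>" by (simp add: mu c algebra_simps)
    also have "\<dots> \<in> convex_cone hull ?S"
      using elim l mu(1) unfolding hull by (intro convex_cone_hull_add convex_cone_hull_mul) auto
    finally have "l + t *\<^sub>R \<eta> \<in> limiting_normal_cone D y" by (simp add: hull)
    then have "(l + t *\<^sub>R \<eta>) \<bullet> (d - y) \<le> 0" if "d \<in> D" for d
      using that by (simp add: limiting_normal_cone_convex[OF polyhedron_imp_convex[OF D(1)]])
    then show ?case
      using elim v by (auto simp: limiting_normal_cone_convex[OF polyhedron_imp_convex[OF D(1)]] inner_simps)
  qed
qed

text \<open>
  The orthogonal complement of the normals is a linear space contained in the critical cone,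
  and a polar vector is nonpositive, hence zero, on a linear space.
\<close>
lemma critical_cone_polar_subset_span:
  assumes D: "polyhedron D" "y \<in> D" and l: "l \<in> limiting_normal_cone D y"
    and z: "\<forall>w\<in>critical_cone D y l. \<zeta> \<bullet> w \<le> 0"
  shows "\<zeta> \<in> span (limiting_normal_cone D y)"
proof -
  let ?N = "limiting_normal_cone D y"
  obtain p q where pq: "p \<in> span ?N" "\<And>w. w \<in> span ?N \<Longrightarrow> orthogonal q w" "\<zeta> = p + q"
    using orthogonal_subspace_decomp_exists[of ?N \<zeta>] by blast
  obtain C where C: "finite C" "D = halfspaces C" using polyhedron_imp_halfspaces[OF D(1)] .
  note T = tangent_cone_halfspaces[OF C(1) D(2)[unfolded C(2)]]
  have "a \<in> ?N" if "a \<in> active C y" for a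
    using that D(2) by (simp add: C limiting_normal_cone_halfspaces hull_inc)
  then have "\<forall>a\<in>active C y. a \<bullet> q = 0"
    using pq(2) by (auto simp: orthogonal_def inner_commute span_base)
  moreover have "l \<bullet> q = 0" using l pq(2) by (auto simp: orthogonal_def inner_commute span_base)
  ultimately have "q \<in> critical_cone D y l" by (simp add: critical_cone_def C T)
  then have "\<zeta> \<bullet> q \<le> 0" using z by blast
  then have "q \<bullet> q \<le> 0" using pq by (simp add: inner_simps orthogonal_def inner_commute)
  then have "q = 0" by (metis inner_ge_zero inner_eq_zero_iff order_antisym)
  then show ?thesis using pq by simp
qed

text \<open>
  The tangent cone to the graph lies in the product of the critical cone and its polar, so every pair
  formed from the polar and the critical cone, in this order, is a regular normal to the graph.
\<close>
lemma tangent_graph_normal_cone: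
  assumes D: "polyhedron D" "y \<in> D"
    and vw: "(v, \<eta>) \<in> tangent_cone (gph (limiting_normal_cone D)) (y, l)"
  shows "v \<in> critical_cone D y l \<and> (\<forall>w\<in>critical_cone D y l. \<eta> \<bullet> w \<le> 0)"
proof -
  from vw obtain t p where t: "\<And>k::nat. t k > (0::real)" "t \<longlonglongrightarrow> 0" and p: "p \<longlonglongrightarrow> (v, \<eta>)"
    and mem: "\<And>k. (y, l) + t k *\<^sub>R p k \<in> gph (limiting_normal_cone D)"
    unfolding tangent_cone_def by blast
  define vk where [abs_def]: "vk k = fst (p k)" for k
  define ek where [abs_def]: "ek k = snd (p k)" for k
  have lim: "vk \<longlonglongrightarrow> v" "ek \<longlonglongrightarrow> \<eta>"
    using tendsto_fst[OF p] tendsto_snd[OF p] by (simp_all add: vk_def ek_def)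
  have N: "l + t k *\<^sub>R ek k \<in> limiting_normal_cone D (y + t k *\<^sub>R vk k)" for k
    using mem[of k] by (simp add: gph_def vk_def ek_def plus_prod_def case_prod_beta)
  have inD: "y + t k *\<^sub>R vk k \<in> D" for k
    using N[of k] by (simp add: limiting_normal_cone_def)
  have vT: "v \<in> tangent_cone D y" unfolding tangent_cone_def using D(2) t lim inD by blast
  have "\<forall>\<^sub>F k in sequentially. l + t k *\<^sub>R ek k \<in> limiting_normal_cone (tangent_cone D y) v"
    by (rule eventually_mono[OF normal_cone_near_direction[OF D t lim(1) inD]]) (use N in blast)
  then have ev: "\<forall>\<^sub>F k in sequentially. (l + t k *\<^sub>R ek k) \<bullet> v = 0 \<and>
      (\<forall>w\<in>tangent_cone D y. (l + t k *\<^sub>R ek k) \<bullet> w \<le> 0)"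
    by (rule eventually_mono)
      (simp add: limiting_normal_cone_of_convex_cone conic_tangent_cone polyhedron_imp_convex
        polyhedron_tangent_cone D)
  have "(\<lambda>k. (l + t k *\<^sub>R ek k) \<bullet> v) \<longlonglongrightarrow> (l + 0 *\<^sub>R \<eta>) \<bullet> v" by (intro tendsto_intros t lim)
  moreover have "(\<lambda>k. (l + t k *\<^sub>R ek k) \<bullet> v) \<longlonglongrightarrow> 0"
    by (rule tendsto_eventually) (use ev in \<open>auto elim: eventually_mono\<close>)
  ultimately have lv: "l \<bullet> v = 0" using LIMSEQ_unique by fastforce
  have "\<eta> \<bullet> w \<le> 0" if w: "w \<in> critical_cone D y l" for w
  proof -
    have "\<forall>\<^sub>F k in sequentially. ek k \<bullet> w \<le> 0"
      using ev
    proof (rule eventually_mono)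
      fix k assume "(l + t k *\<^sub>R ek k) \<bullet> v = 0 \<and> (\<forall>w\<in>tangent_cone D y. (l + t k *\<^sub>R ek k) \<bullet> w \<le> 0)"
      then have "t k * (ek k \<bullet> w) \<le> 0" using w by (auto simp: critical_cone_def inner_simps)
      then show "ek k \<bullet> w \<le> 0" using t(1)[of k] by (simp add: mult_le_0_iff)
    qed
    then show ?thesis
      by (intro tendsto_upperbound[OF tendsto_inner[OF lim(2) tendsto_const]]) auto
  qed
  then show ?thesis using vT lv by (simp add: critical_cone_def)
qed

text \<open>
  Each inequality defining the critical cone is given by a vector of its polar: an active
  normal, \<open>l\<close> or \<open>- l\<close>.
\<close>
lemma critical_cone_bipolar:
  assumes D: "polyhedron D" "y \<in> D" and l: "l \<in> limiting_normal_cone D y"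
    and z: "\<And>\<eta>. (\<forall>w\<in>critical_cone D y l. \<eta> \<bullet> w \<le> 0) \<Longrightarrow> \<eta> \<bullet> z \<le> 0"
  shows "z \<in> critical_cone D y l"
proof -
  obtain C where C: "finite C" "D = halfspaces C" using polyhedron_imp_halfspaces[OF D(1)] .
  note T = tangent_cone_halfspaces[OF C(1) D(2)[unfolded C(2)]]
  have "a \<bullet> z \<le> 0" if "a \<in> active C y" for a
    using that by (intro z) (auto simp: critical_cone_def C T)
  moreover have "l \<bullet> z \<le> 0" "(- l) \<bullet> z \<le> 0"
    by (rule z; auto simp: critical_cone_def)+
  ultimately show ?thesis by (simp add: critical_cone_def C T)
qed

section \<open>Derivatives of first and second order\<close>

text \<open>
  The directions \<open>u k\<close> are merely bounded, since the symmetry of the second derivative needs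
  directions that depend on an intermediate point of the mean value theorem.
\<close>
lemma has_derivative_quotient_error:
  fixes h :: "'a::real_normed_vector \<Rightarrow> 'b::real_normed_vector"
  assumes h: "(h has_derivative h') (at x)"
    and t: "\<forall>\<^sub>F k in F. t k > (0::real)" "(t \<longlongrightarrow> 0) F"
    and u: "\<forall>\<^sub>F k in F. norm (u k) \<le> B"
  shows "((\<lambda>k. (h (x + t k *\<^sub>R u k) - h x) /\<^sub>R t k - h' (u k)) \<longlongrightarrow> 0) F"
proof (rule tendstoI)
  let ?q = "\<lambda>k. (h (x + t k *\<^sub>R u k) - h x) /\<^sub>R t k"
  have lin: "linear h'" using h by (rule has_derivative_linear)
  fix e :: real assume e: "e > 0"
  \<comment> \<open>With absolute value and summand 1 the bound is usable for every real \<open>B\<close>.\<close>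
  define c where "c = e / (\<bar>B\<bar> + 1)"
  have c: "c > 0" using e by (simp add: c_def)
  then obtain d where d: "d > 0"
    "\<And>y. norm (y - x) < d \<Longrightarrow> norm (h y - h x - h' (y - x)) \<le> c * norm (y - x)"
    using h unfolding has_derivative_at_alt by blast
  have "((\<lambda>k. t k * (\<bar>B\<bar> + 1)) \<longlongrightarrow> 0 * (\<bar>B\<bar> + 1)) F" by (intro tendsto_intros t)
  then have "\<forall>\<^sub>F k in F. t k * (\<bar>B\<bar> + 1) < d" using d(1) by (auto dest: order_tendstoD(2))
  with t(1) u show "\<forall>\<^sub>F k in F. dist (?q k - h' (u k)) 0 < e"
  proof eventually_elim
    case (elim k)
    have "norm (t k *\<^sub>R u k) \<le> t k * (\<bar>B\<bar> + 1)" using elim by (simp add: mult_left_mono)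
    also have "\<dots> < d" using elim by simp
    finally have est: "norm (h (x + t k *\<^sub>R u k) - h x - h' (t k *\<^sub>R u k)) \<le> c * norm (t k *\<^sub>R u k)"
      using d(2)[of "x + t k *\<^sub>R u k"] by simp
    have eq: "h (x + t k *\<^sub>R u k) - h x - h' (t k *\<^sub>R u k) = t k *\<^sub>R (?q k - h' (u k))"
      using elim by (simp add: linear_cmul[OF lin] scaleR_diff_right)
    have "t k * norm (?q k - h' (u k)) = norm (t k *\<^sub>R (?q k - h' (u k)))" using elim by simp
    also have "\<dots> \<le> c * norm (t k *\<^sub>R u k)" using est by (simp only: eq)
    also have "\<dots> = t k * (c * norm (u k))" using elim by simp
    finally have "t k * norm (?q k - h' (u k)) \<le> t k * (c * norm (u k))" .
    then have "norm (?q k - h' (u k)) \<le> c * norm (u k)" using elim by simp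
    also have "\<dots> < c * (\<bar>B\<bar> + 1)" using c elim by simp
    also have "\<dots> = e" by (simp add: c_def)
    finally show ?case by simp
  qed
qed

lemma has_derivative_directional_quotient:
  fixes h :: "'a::real_normed_vector \<Rightarrow> 'b::real_normed_vector"
  assumes h: "(h has_derivative h') (at x)"
    and t: "\<forall>\<^sub>F k in F. t k > (0::real)" "(t \<longlongrightarrow> 0) F" and u: "(u \<longlongrightarrow> u0) F"
  shows "((\<lambda>k. (h (x + t k *\<^sub>R u k) - h x) /\<^sub>R t k) \<longlongrightarrow> h' u0) F"
proof -
  have "((\<lambda>k. norm (u k)) \<longlongrightarrow> norm u0) F" by (intro tendsto_intros u)
  then have "\<forall>\<^sub>F k in F. norm (u k) < norm u0 + 1" by (rule order_tendstoD(2)) simp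
  then have "\<forall>\<^sub>F k in F. norm (u k) \<le> norm u0 + 1" by (rule eventually_mono) simp
  from has_derivative_quotient_error[OF h t this]
  have "((\<lambda>k. (h (x + t k *\<^sub>R u k) - h x) /\<^sub>R t k - h' (u k)) \<longlongrightarrow> 0) F" .
  moreover have "((\<lambda>k. h' (u k)) \<longlongrightarrow> h' u0) F"
    using bounded_linear.tendsto[OF has_derivative_bounded_linear[OF h] u] .
  ultimately show ?thesis by (rule Lim_transform[rotated])
qed

text \<open>
  The second difference \<open>\<Delta> t h k\<close> is symmetric in \<open>h\<close> and \<open>k\<close>, and the mean value theorem shows that
  \<open>\<Delta> t h k / t\<^sup>2\<close> tends to the second derivative in one of the two orders.
\<close>
lemma second_derivative_symmetric:
  fixes f :: "'a::real_normed_vector \<Rightarrow> real"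
  assumes f: "\<And>y. (f has_derivative blinfun_apply (f' y)) (at y)"
    and f': "(f' has_derivative f'') (at x)"
  shows "blinfun_apply (f'' h) k = blinfun_apply (f'' k) h"
proof -
  define \<Delta> where "\<Delta> t h k = f (x + t *\<^sub>R h + t *\<^sub>R k) - f (x + t *\<^sub>R h) - f (x + t *\<^sub>R k) + f x"
    for t :: real and h k
  have lim: "((\<lambda>t. \<Delta> t h k /\<^sub>R t\<^sup>2) \<longlongrightarrow> blinfun_apply (f'' k) h) (at_right 0)" for h k
  proof -
    have "\<exists>s. 0 < s \<and> s < 1 \<and> \<Delta> t h k =
        (f' (x + s *\<^sub>R (t *\<^sub>R h) + t *\<^sub>R k)) (t *\<^sub>R h) - (f' (x + s *\<^sub>R (t *\<^sub>R h))) (t *\<^sub>R h)" for t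
    proof -
      let ?p = "\<lambda>s. f (x + s *\<^sub>R (t *\<^sub>R h) + t *\<^sub>R k) - f (x + s *\<^sub>R (t *\<^sub>R h))"
      let ?p' = "\<lambda>s. (f' (x + s *\<^sub>R (t *\<^sub>R h) + t *\<^sub>R k)) (t *\<^sub>R h) - (f' (x + s *\<^sub>R (t *\<^sub>R h))) (t *\<^sub>R h)"
      have "DERIV ?p s :> ?p' s" for s
        unfolding has_field_derivative_def
        by (auto intro!: derivative_eq_intros has_derivative_compose[OF _ f] simp: blinfun.scaleR_right algebra_simps)
      from MVT2[of 0 1 ?p ?p', OF _ this] show ?thesis by (auto simp: \<Delta>_def algebra_simps)
    qed
    then obtain s where s: "\<And>t. 0 < s t \<and> s t < 1"
      "\<And>t. \<Delta> t h k = (f' (x + s t *\<^sub>R (t *\<^sub>R h) + t *\<^sub>R k)) (t *\<^sub>R h) - (f' (x + s t *\<^sub>R (t *\<^sub>R h))) (t *\<^sub>R h)"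
      by metis
    let ?e = "\<lambda>u t. (f' (x + t *\<^sub>R u t) - f' x) /\<^sub>R t - f'' (u t)"
    have pos: "\<forall>\<^sub>F t in at_right (0::real). t > 0" by (rule eventually_at_right_less)
    have sb: "norm (s t *\<^sub>R h) \<le> norm h" for t using s(1)[of t] by (simp add: mult_left_le_one_le)
    then have "norm (s t *\<^sub>R h + k) \<le> norm h + norm k" for t
      using norm_triangle_ineq[of "s t *\<^sub>R h" k] by (smt (verit))
    then have e1: "(?e (\<lambda>t. s t *\<^sub>R h + k) \<longlongrightarrow> 0) (at_right 0)"
      by (intro has_derivative_quotient_error[OF f' pos] tendsto_ident_at always_eventually) auto
    have e2: "(?e (\<lambda>t. s t *\<^sub>R h) \<longlongrightarrow> 0) (at_right 0)"
      using sb by (intro has_derivative_quotient_error[OF f' pos] tendsto_ident_at always_eventually) auto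
    have "((\<lambda>t. blinfun_apply (f'' k + (?e (\<lambda>t. s t *\<^sub>R h + k) t - ?e (\<lambda>t. s t *\<^sub>R h) t)) h)
        \<longlongrightarrow> blinfun_apply (f'' k + (0 - 0)) h) (at_right 0)"
      by (intro tendsto_intros e1 e2)
    moreover have "\<forall>\<^sub>F t in at_right 0.
        blinfun_apply (f'' k + (?e (\<lambda>t. s t *\<^sub>R h + k) t - ?e (\<lambda>t. s t *\<^sub>R h) t)) h = \<Delta> t h k /\<^sub>R t\<^sup>2"
      using pos
    proof eventually_elim
      case (elim t)
      have "x + s t *\<^sub>R (t *\<^sub>R h) + t *\<^sub>R k = x + t *\<^sub>R (s t *\<^sub>R h + k)"
        "x + s t *\<^sub>R (t *\<^sub>R h) = x + t *\<^sub>R (s t *\<^sub>R h)" by (simp_all add: algebra_simps)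
      then have "\<Delta> t h k = t * (blinfun_apply (f' (x + t *\<^sub>R (s t *\<^sub>R h + k)) - f' (x + t *\<^sub>R (s t *\<^sub>R h))) h)"
        using s(2)[of t] by (simp add: blinfun.scaleR_right blinfun.diff_left algebra_simps)
      then have "\<Delta> t h k /\<^sub>R t\<^sup>2 = (blinfun_apply (f' (x + t *\<^sub>R (s t *\<^sub>R h + k)) - f' (x + t *\<^sub>R (s t *\<^sub>R h))) h) /\<^sub>R t"
        using elim by (simp add: power2_eq_square)
      moreover have "f'' k + (?e (\<lambda>t. s t *\<^sub>R h + k) t - ?e (\<lambda>t. s t *\<^sub>R h) t)
         = (f' (x + t *\<^sub>R (s t *\<^sub>R h + k)) - f' (x + t *\<^sub>R (s t *\<^sub>R h))) /\<^sub>R t"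
        by (simp add: linear_add[OF has_derivative_linear[OF f']] algebra_simps)
      ultimately show ?case by (simp add: blinfun.scaleR_left)
    qed
    ultimately show ?thesis by (simp add: tendsto_cong)
  qed
  have "\<Delta> t h k = \<Delta> t k h" for t by (simp add: \<Delta>_def algebra_simps)
  then show ?thesis
    using tendsto_unique[OF trivial_limit_at_right_real lim[of k h]] lim[of h k] by simp
qed

text \<open>
  The Jacobian and the Hessian matrix are tied here to the abstract first and second derivatives; later
  arguments use the matrices through the limit rules of this locale.
\<close>
locale twice_differentiable_map =
  fixes g :: "real ^ 'n \<Rightarrow> real ^ 's"
    and J :: "real ^ 'n \<Rightarrow> real ^ 'n ^ 's"
    and H :: "real ^ 's \<Rightarrow> real ^ 'n \<Rightarrow> real ^ 'n ^ 'n"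
  assumes C2: "twice_continuously_differentiable g"
    and J: "J = (\<lambda>x. jacobian g (at x))"
    and H: "H = (\<lambda>l. hessian (\<lambda>x. l \<bullet> g x))"
begin

lemma derivatives:
  obtains g' :: "real ^ 'n \<Rightarrow> (real ^ 'n) \<Rightarrow>\<^sub>L (real ^ 's)"
    and g'' :: "real ^ 'n \<Rightarrow> (real ^ 'n) \<Rightarrow>\<^sub>L ((real ^ 'n) \<Rightarrow>\<^sub>L (real ^ 's))"
  where "\<And>x. (g has_derivative blinfun_apply (g' x)) (at x)"
    and "\<And>x. (g' has_derivative blinfun_apply (g'' x)) (at x)"
    and "continuous_on UNIV g''"
    and "\<And>x u. J x *v u = g' x u"
    and "\<And>l x u w. (H l x *v u) \<bullet> w = l \<bullet> g'' x u w"
proof -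
  obtain g' :: "real ^ 'n \<Rightarrow> (real ^ 'n) \<Rightarrow>\<^sub>L (real ^ 's)"
    and g'' :: "real ^ 'n \<Rightarrow> (real ^ 'n) \<Rightarrow>\<^sub>L ((real ^ 'n) \<Rightarrow>\<^sub>L (real ^ 's))"
    where g': "\<And>x. (g has_derivative blinfun_apply (g' x)) (at x)"
      and g'': "\<And>x. (g' has_derivative blinfun_apply (g'' x)) (at x)"
      and cont: "continuous_on UNIV g''"
    using C2 unfolding twice_continuously_differentiable_def by blast
  have mw: "matrix (blinfun_apply B) *v w = blinfun_apply B w" for B :: "(real ^ 'n) \<Rightarrow>\<^sub>L (real ^ 's)" and w
    by (rule fun_cong[OF matrix_vector_mul(3)[OF blinfun.bounded_linear_right]])
  have Jg': "J x *v u = g' x u" for x u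
    by (simp add: J jacobian_def frechet_derivative_at[OF g', symmetric] mw)
  have grad: "gradient (\<lambda>x. l \<bullet> g x) = (\<lambda>x. transpose (J x) *v l)" for l
  proof
    fix x
    have "((\<lambda>x. l \<bullet> g x) has_derivative (\<lambda>u. l \<bullet> g' x u)) (at x)"
      by (intro has_derivative_inner_right g')
    then have "frechet_derivative (\<lambda>x. l \<bullet> g x) (at x) = (\<lambda>u. l \<bullet> g' x u)"
      by (rule frechet_derivative_at[symmetric])
    then have "gradient (\<lambda>x. l \<bullet> g x) x $ i = (transpose (J x) *v l) \<bullet> axis i 1" for i
      by (simp add: gradient_def inner_transpose_matrix Jg')
    then show "gradient (\<lambda>x. l \<bullet> g x) x = transpose (J x) *v l" by (simp add: vec_eq_iff inner_axis)
  qed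
  have der: "((\<lambda>x. transpose (J x) *v l) has_derivative (\<lambda>u. transpose (matrix (g'' x u)) *v l)) (at x)"
    for l x
  proof (rule has_derivative_componentwise_within[THEN iffD2], rule ballI)
    fix i :: "real ^ 'n"
    have "((\<lambda>x. l \<bullet> g' x i) has_derivative (\<lambda>u. l \<bullet> g'' x u i)) (at x)"
      by (intro has_derivative_inner_right bounded_linear.has_derivative[OF blinfun.bounded_linear_left] g'')
    then show "((\<lambda>x. (transpose (J x) *v l) \<bullet> i) has_derivative
       (\<lambda>u. (transpose (matrix (g'' x u)) *v l) \<bullet> i)) (at x)"
      by (simp add: inner_transpose_matrix Jg' mw)
  qed
  have Hg'': "(H l x *v u) \<bullet> w = l \<bullet> g'' x u w" for l x u w
  proof -
    have "H l x *v u = transpose (matrix (g'' x u)) *v l"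
      using fun_cong[OF matrix_vector_mul(3)[OF has_derivative_bounded_linear[OF der[of l x]]], of u]
      by (simp add: H hessian_def jacobian_def grad frechet_derivative_at[OF der, symmetric])
    then show ?thesis
      by (simp add: inner_transpose_matrix mw)
  qed
  show ?thesis using that g' g'' cont Jg' Hg'' by blast
qed

lemma has_derivative_map: "(g has_derivative (*v) (J x)) (at x)"
  by (rule derivatives) (metis (no_types, lifting) ext)

lemma map_quotient:
  assumes "\<forall>\<^sub>F k in F. t k > (0::real)" "(t \<longlongrightarrow> 0) F" "(u \<longlongrightarrow> u0) F"
  shows "((\<lambda>k. (g (x + t k *\<^sub>R u k) - g x) /\<^sub>R t k) \<longlongrightarrow> J x *v u0) F"
  by (rule has_derivative_directional_quotient[OF has_derivative_map assms])

lemma tendsto_map: "(y \<longlongrightarrow> x) F \<Longrightarrow> ((\<lambda>k. g (y k)) \<longlongrightarrow> g x) F"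
  by (rule isCont_tendsto_compose[OF has_derivative_continuous[OF has_derivative_map]])

lemma tendsto_jacobian:
  assumes "(y \<longlongrightarrow> x) F" "(u \<longlongrightarrow> v) F"
  shows "((\<lambda>k. J (y k) *v u k) \<longlongrightarrow> J x *v v) F"
proof -
  obtain g' g'' where d: "\<And>x. (g' has_derivative blinfun_apply (g'' x)) (at x)"
    and Jg: "\<And>x u. J x *v u = blinfun_apply (g' x) u" using derivatives by metis
  have "((\<lambda>k. g' (y k)) \<longlongrightarrow> g' x) F"
    by (rule isCont_tendsto_compose[OF has_derivative_continuous[OF d] assms(1)])
  then show ?thesis unfolding Jg by (intro tendsto_intros assms)
qed

lemma tendsto_jacobian_transpose:
  assumes "(y \<longlongrightarrow> x) F" "(l \<longlongrightarrow> l0) F"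
  shows "((\<lambda>k. transpose (J (y k)) *v l k) \<longlongrightarrow> transpose (J x) *v l0) F"
  by (rule tendsto_componentwise_iff[THEN iffD2])
     (auto simp: inner_transpose_matrix intro!: tendsto_intros tendsto_jacobian assms)

lemma hessian_symmetric: "(H l x *v u) \<bullet> w = u \<bullet> (H l x *v w)"
proof -
  obtain g' g'' where d: "\<And>x. (g has_derivative blinfun_apply (g' x)) (at x)"
    "\<And>x. (g' has_derivative blinfun_apply (g'' x)) (at x)"
    and Hg: "\<And>l x u w. (H l x *v u) \<bullet> w = l \<bullet> (blinfun_apply (blinfun_apply (g'' x) u) w)"
    using derivatives by metis
  have "((\<lambda>x. l \<bullet> g x) has_derivative blinfun_apply (blinfun_inner_right l o\<^sub>L g' y)) (at y)" for y
    by (auto intro!: derivative_eq_intros d)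
  moreover have "((\<lambda>y. blinfun_inner_right l o\<^sub>L g' y) has_derivative
      (\<lambda>u. blinfun_inner_right l o\<^sub>L g'' x u)) (at x)"
    by (intro bounded_linear.has_derivative[OF bounded_bilinear.bounded_linear_right[OF bounded_bilinear_blinfun_compose]] d)
  ultimately have "blinfun_apply (blinfun_inner_right l o\<^sub>L g'' x u) w = blinfun_apply (blinfun_inner_right l o\<^sub>L g'' x w) u"
    by (rule second_derivative_symmetric)
  then show ?thesis by (simp add: Hg inner_commute[of u])
qed

lemma tendsto_hessian:
  assumes "(y \<longlongrightarrow> x) F" "(l \<longlongrightarrow> l0) F" "(u \<longlongrightarrow> v) F"
  shows "((\<lambda>k. H (l k) (y k) *v u k) \<longlongrightarrow> H l0 x *v v) F"
proof -
  obtain g'' where c: "continuous_on UNIV g''"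
    and Hg: "\<And>l x u w. (H l x *v u) \<bullet> w = l \<bullet> (blinfun_apply (blinfun_apply (g'' x) u) w)"
    using derivatives by metis
  have "((\<lambda>k. g'' (y k)) \<longlongrightarrow> g'' x) F"
    using c assms(1) by (auto intro: isCont_tendsto_compose simp: continuous_on_eq_continuous_at)
  then show ?thesis
    by (subst tendsto_componentwise_iff) (auto simp: Hg intro!: tendsto_intros assms)
qed

text \<open>
  This limit produces the Hessian term. The multiplier may vary with the point, because the
  difference quotient of the derivative converges in the operator norm.
\<close>
lemma jacobian_transpose_quotient:
  assumes t: "\<forall>\<^sub>F k in F. t k > (0::real)" "(t \<longlongrightarrow> 0) F" and u: "(u \<longlongrightarrow> u0) F"
    and l: "(l \<longlongrightarrow> l0) F"
  shows "((\<lambda>k. (transpose (J (x + t k *\<^sub>R u k)) *v l k - transpose (J x) *v l k) /\<^sub>R t k)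
     \<longlongrightarrow> H l0 x *v u0) F"
proof -
  obtain g' g'' where d: "\<And>x. (g' has_derivative blinfun_apply (g'' x)) (at x)"
    and Jg: "\<And>x u. J x *v u = blinfun_apply (g' x) u"
    and Hg: "\<And>l x u w. (H l x *v u) \<bullet> w = l \<bullet> (blinfun_apply (blinfun_apply (g'' x) u) w)"
    using derivatives by metis
  have q: "((\<lambda>k. (g' (x + t k *\<^sub>R u k) - g' x) /\<^sub>R t k) \<longlongrightarrow> g'' x u0) F"
    by (rule has_derivative_directional_quotient[OF d t u])
  show ?thesis
  proof (subst tendsto_componentwise_iff, rule ballI)
    fix i :: "real ^ 'n"
    have "((\<lambda>k. l k \<bullet> (blinfun_apply ((g' (x + t k *\<^sub>R u k) - g' x) /\<^sub>R t k) i)) \<longlongrightarrow> l0 \<bullet> (g'' x u0 i)) F"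
      by (intro tendsto_intros q l)
    then show "((\<lambda>k. ((transpose (J (x + t k *\<^sub>R u k)) *v l k - transpose (J x) *v l k) /\<^sub>R t k) \<bullet> i)
     \<longlongrightarrow> (H l0 x *v u0) \<bullet> i) F"
      by (simp add: Hg inner_diff_left inner_transpose_matrix Jg blinfun.diff_left blinfun.scaleR_left inner_diff_right)
  qed
qed

lemma strict_derivative:
  assumes "\<epsilon> > 0"
  shows "\<exists>\<delta>>0. \<forall>y\<in>ball x \<delta>. \<forall>z\<in>ball x \<delta>. norm (g y - g z - J x *v (y - z)) \<le> \<epsilon> * norm (y - z)"
proof -
  obtain g' g'' where d: "\<And>x. (g has_derivative blinfun_apply (g' x)) (at x)"
    and d2: "\<And>x. (g' has_derivative blinfun_apply (g'' x)) (at x)"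
    and Jg: "\<And>x u. J x *v u = blinfun_apply (g' x) u" using derivatives by metis
  obtain \<delta> where \<delta>: "\<delta> > 0" "\<And>y. dist y x < \<delta> \<Longrightarrow> dist (g' y) (g' x) < \<epsilon>"
    using has_derivative_continuous[OF d2[of x]] assms unfolding continuous_at_eps_delta by blast
  have "norm (g y - g z - g' x (y - z)) \<le> norm (y - z) * \<epsilon>" if "y \<in> ball x \<delta>" "z \<in> ball x \<delta>" for y z
  proof (rule differentiable_bound_linearization[where S = "ball x \<delta>" and f' = "\<lambda>x. blinfun_apply (g' x)"])
    show "z + t *\<^sub>R (y - z) \<in> ball x \<delta>" if "t \<in> {0..1}" for t
      using convexD_alt[OF convex_ball \<open>z \<in> ball x \<delta>\<close> \<open>y \<in> ball x \<delta>\<close>, of t] that by (simp add: algebra_simps)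
    show "(g has_derivative blinfun_apply (g' \<xi>)) (at \<xi> within ball x \<delta>)" for \<xi>
      using d has_derivative_at_withinI by blast
    show "onorm (blinfun_apply (g' \<xi>) - blinfun_apply (g' x)) \<le> \<epsilon>" if "\<xi> \<in> ball x \<delta>" for \<xi>
    proof -
      have "dist (g' \<xi>) (g' x) < \<epsilon>" using \<delta>(2)[of \<xi>] that by (simp add: dist_commute)
      then show ?thesis
        by (simp add: dist_norm norm_blinfun.rep_eq minus_blinfun.rep_eq fun_diff_def)
    qed
  qed (use \<delta> in auto)
  then show ?thesis using \<delta>(1) by (auto simp: Jg mult.commute[of \<epsilon>])
qed

lemma jacobian_transpose_perturbation:
  assumes y: "(y \<longlongrightarrow> x) F" and e: "e > 0"
  shows "\<forall>\<^sub>F k in F. \<forall>\<zeta>. norm (transpose (J (y k)) *v \<zeta> - transpose (J x) *v \<zeta>) \<le> e * norm \<zeta>"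
proof -
  obtain g' g'' where d: "\<And>x. (g' has_derivative blinfun_apply (g'' x)) (at x)"
    and Jg: "\<And>x u. J x *v u = blinfun_apply (g' x) u" using derivatives by metis
  have "((\<lambda>k. g' (y k)) \<longlongrightarrow> g' x) F"
    by (rule isCont_tendsto_compose[OF has_derivative_continuous[OF d] y])
  from tendstoD[OF this e] show ?thesis
  proof (rule eventually_mono, intro allI)
    fix k \<zeta> assume k: "dist (g' (y k)) (g' x) < e"
    define a where "a = transpose (J (y k)) *v \<zeta> - transpose (J x) *v \<zeta>"
    have "norm a * norm a = a \<bullet> a" by (simp add: power2_norm_eq_inner[symmetric] power2_eq_square)
    also have "\<dots> = \<zeta> \<bullet> blinfun_apply (g' (y k) - g' x) a"
      by (subst (1) a_def) (simp add: inner_diff_left inner_diff_right inner_transpose_matrix Jg blinfun.diff_left)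
    also have "\<dots> \<le> norm \<zeta> * (e * norm a)"
    proof (rule order_trans[OF norm_cauchy_schwarz], rule mult_left_mono)
      show "norm (blinfun_apply (g' (y k) - g' x) a) \<le> e * norm a"
        using k norm_blinfun[of "g' (y k) - g' x" a]
        by (elim order_trans) (simp add: dist_norm mult_right_mono)
    qed simp
    finally have "norm a * norm a \<le> (e * norm \<zeta>) * norm a" by (simp add: mult_ac)
    then show "norm (transpose (J (y k)) *v \<zeta> - transpose (J x) *v \<zeta>) \<le> e * norm \<zeta>"
      unfolding a_def[symmetric] using e by (cases "a = 0") auto
  qed
qed

end

section \<open>Solving equations in a subspace\<close>

text \<open>
  Orthogonality of the remainder determines the projection uniquely, which makes it linear.
\<close>
lemma orthogonal_projection_exists:
  fixes S :: "'a::euclidean_space set"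
  assumes S: "subspace S"
  obtains P where "linear P" "\<And>y. P y \<in> S" "\<And>y s. s \<in> S \<Longrightarrow> (y - P y) \<bullet> s = 0" "\<And>y. norm (P y) \<le> norm y"
proof -
  have "\<exists>p. p \<in> S \<and> (\<forall>s\<in>S. (y - p) \<bullet> s = 0)" for y
    using orthogonal_subspace_decomp_exists[of S y] S
    by (metis add_diff_cancel_left' orthogonal_def span_eq_iff)
  then obtain P where P: "\<And>y. P y \<in> S" "\<And>y s. s \<in> S \<Longrightarrow> (y - P y) \<bullet> s = 0" by metis
  have unique: "P y = p" if "p \<in> S" "\<And>s. s \<in> S \<Longrightarrow> (y - p) \<bullet> s = 0" for y p
  proof -
    have d: "P y - p \<in> S" using subspace_diff[OF S P(1) that(1)] .
    have "(P y - p) \<bullet> (P y - p) = (y - p) \<bullet> (P y - p) - (y - P y) \<bullet> (P y - p)" by (simp add: inner_simps)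
    also have "\<dots> = 0" using that(2)[OF d] P(2)[OF d] by simp
    finally show ?thesis by simp
  qed
  have lin: "linear P"
  proof (rule linearI)
    show "P (x + y) = P x + P y" for x y
    proof (rule unique)
      fix s assume "s \<in> S"
      then have "(x - P x) \<bullet> s + (y - P y) \<bullet> s = 0" using P(2) by simp
      then show "(x + y - (P x + P y)) \<bullet> s = 0" by (simp add: inner_simps)
    qed (intro subspace_add[OF S] P(1))
    show "P (c *\<^sub>R x) = c *\<^sub>R P x" for c x
    proof (rule unique)
      fix s assume "s \<in> S"
      then have "c * ((x - P x) \<bullet> s) = 0" using P(2) by simp
      then show "(c *\<^sub>R x - c *\<^sub>R P x) \<bullet> s = 0" by (simp add: inner_simps right_diff_distrib)
    qed (intro subspace_scale[OF S] P(1))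
  qed
  have "norm (P y) \<le> norm y" for y
  proof -
    have "norm (P y) * norm (P y) = P y \<bullet> P y" by (simp add: power2_norm_eq_inner[symmetric] power2_eq_square)
    also have "\<dots> = y \<bullet> P y" using P(2)[OF P(1), of y y] by (simp add: inner_simps)
    also have "\<dots> \<le> norm y * norm (P y)" by (rule norm_cauchy_schwarz)
    finally show ?thesis by (cases "P y = 0") auto
  qed
  with lin P show ?thesis using that by blast
qed

text \<open>
  A quantitative Lyusternik-Graves theorem. With a right inverse \<open>B\<close> of the derivative, the equation
  \<open>h (x' + B s) = q\<close> is a fixed point problem for \<open>s - (h (x' + B s) - q)\<close>, a contraction with
  constant \<open>1/2\<close> that maps the ball of twice the residual into itself.
\<close>
lemma solvability_from_right_inverse:
  fixes h :: "'a::euclidean_space \<Rightarrow> 'b::euclidean_space"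
  assumes strict: "\<And>\<epsilon>. \<epsilon> > 0 \<Longrightarrow> \<exists>\<delta>>0. \<forall>y\<in>ball x \<delta>. \<forall>z\<in>ball x \<delta>. norm (h y - h z - A (y - z)) \<le> \<epsilon> * norm (y - z)"
    and S: "subspace S" "\<And>y. h y \<in> S"
    and B: "linear B" "\<And>s. s \<in> S \<Longrightarrow> A (B s) = s"
  obtains \<delta> c where "\<delta> > 0" "c > 0"
    "\<And>x' q. \<lbrakk>x' \<in> ball x \<delta>; q \<in> S; norm (h x' - q) < \<delta>\<rbrakk> \<Longrightarrow> \<exists>y. h y = q \<and> norm (y - x') \<le> c * norm (h x' - q)"
proof -
  obtain b where b: "b > 0" "\<And>s. norm (B s) \<le> b * norm s"
    using linear_bounded_pos[OF B(1)] by blast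
  obtain \<delta>0 where d0: "\<delta>0 > 0"
    "\<And>y z. \<lbrakk>y \<in> ball x \<delta>0; z \<in> ball x \<delta>0\<rbrakk> \<Longrightarrow> norm (h y - h z - A (y - z)) \<le> (1 / (2 * b)) * norm (y - z)"
    using strict[of "1 / (2 * b)"] b(1) by auto
  \<comment> \<open>The iterates \<open>x' + B s\<close> stray from \<open>x\<close> by less than \<open>\<delta> + b * (2 * \<delta>)\<close>, which equals \<open>\<delta>0\<close>.\<close>
  define \<delta> where "\<delta> = \<delta>0 / (1 + 2 * b)"
  have dpos: "\<delta> > 0" using d0(1) b(1) by (simp add: \<delta>_def)
  have "\<exists>y. h y = q \<and> norm (y - x') \<le> (2 * b) * norm (h x' - q)"
    if x': "x' \<in> ball x \<delta>" and q: "q \<in> S" and r: "norm (h x' - q) < \<delta>" for x' q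
  proof -
    define r where "r = norm (h x' - q)"
    define X where "X = S \<inter> cball 0 (2 * r)"
    define \<phi> where "\<phi> s = s - (h (x' + B s) - q)" for s
    have r0: "r \<ge> 0" "r < \<delta>" using r by (simp_all add: r_def)
    have inb: "x' + B s \<in> ball x \<delta>0" if "s \<in> X" for s
    proof -
      have "norm (B s) \<le> b * (2 * r)" using b(2)[of s] that b(1) by (auto simp: X_def intro: order_trans)
      also have "\<dots> \<le> b * (2 * \<delta>)" using b(1) r0 by simp
      finally have "norm (x' + B s - x) < \<delta> + b * (2 * \<delta>)"
        using x' norm_triangle_ineq[of "x' - x" "B s"] by (simp add: dist_norm norm_minus_commute algebra_simps)
      also have "\<dots> = \<delta> * (1 + 2 * b)" by (simp add: algebra_simps)
      also have "\<dots> = \<delta>0" using b(1) by (simp add: \<delta>_def)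
      finally show ?thesis by (simp add: dist_norm norm_minus_commute)
    qed
    have contr: "dist (\<phi> s) (\<phi> s') \<le> (1/2) * dist s s'" if "s \<in> X" "s' \<in> X" for s s'
    proof -
      have "s - s' \<in> S" using that subspace_diff[OF S(1)] by (auto simp: X_def)
      then have "A ((x' + B s) - (x' + B s')) = s - s'" using B by (simp add: linear_diff[symmetric])
      then have "\<phi> s - \<phi> s' = - (h (x' + B s) - h (x' + B s') - A ((x' + B s) - (x' + B s')))"
        by (simp only: \<phi>_def) simp
      then have "dist (\<phi> s) (\<phi> s') = norm (h (x' + B s) - h (x' + B s') - A ((x' + B s) - (x' + B s')))"
        by (simp only: dist_norm norm_minus_cancel)
      also have "\<dots> \<le> (1 / (2 * b)) * norm (B (s - s'))"
        using d0(2)[OF inb[OF that(1)] inb[OF that(2)]] by (simp add: linear_diff[OF B(1)])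
      also have "\<dots> \<le> (1 / (2 * b)) * (b * norm (s - s'))"
        using b by (intro mult_left_mono) auto
      also have "\<dots> = (1/2) * dist s s'" using b(1) by (simp add: dist_norm)
      finally show ?thesis .
    qed
    have zero: "0 \<in> X" using subspace_0[OF S(1)] r0 by (simp add: X_def)
    have phi0: "norm (\<phi> 0) = r" using linear_0[OF B(1)] by (simp add: \<phi>_def r_def norm_minus_commute)
    have "\<phi> ` X \<subseteq> X"
    proof
      fix p assume "p \<in> \<phi> ` X"
      then obtain s where s: "s \<in> X" "p = \<phi> s" by blast
      have "p \<in> S" using s q S by (auto simp: \<phi>_def X_def intro!: subspace_diff)
      moreover have "norm p \<le> norm (\<phi> 0) + dist (\<phi> s) (\<phi> 0)"
        using norm_triangle_ineq[of "\<phi> 0" "\<phi> s - \<phi> 0"] s by (simp add: dist_norm)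
      then have "norm p \<le> 2 * r" using contr[OF s(1) zero] phi0 s(1) by (simp add: X_def)
      ultimately show "p \<in> X" by (simp add: X_def)
    qed
    moreover have "complete X"
      unfolding X_def by (intro compact_imp_complete closed_Int_compact closed_subspace S(1) compact_cball)
    ultimately obtain s where s: "s \<in> X" "\<phi> s = s"
      using Banach_fix[of X "1/2" \<phi>] contr zero by auto
    have "norm (B s) \<le> b * (2 * r)" using b(2)[of s] s(1) b(1) by (auto simp: X_def intro: order_trans)
    then show ?thesis
      using s(2) by (intro exI[of _ "x' + B s"]) (simp add: \<phi>_def r_def)
  qed
  then show ?thesis using that[OF dpos, of "2 * b"] b(1) by simp
qed

text \<open>
  Injectivity of \<open>A\<^sup>T\<close> on \<open>S\<close> dualises to surjectivity of the projected map onto \<open>S\<close>: a vector of \<open>S\<close>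
  orthogonal to the range is annihilated by \<open>A\<^sup>T\<close>.
\<close>
lemma subspace_injective_right_inverse:
  fixes A :: "real ^ 'n ^ 's"
  assumes S: "subspace S" and P: "linear P" "\<And>y. P y \<in> S" "\<And>y s. s \<in> S \<Longrightarrow> (y - P y) \<bullet> s = 0"
    and inj: "\<And>s. s \<in> S \<Longrightarrow> transpose A *v s = 0 \<Longrightarrow> s = 0"
  obtains B where "linear B" "\<And>s. s \<in> S \<Longrightarrow> P (A *v B s) = s"
proof -
  let ?f = "\<lambda>w. P (A *v w)"
  have lin: "linear ?f" using linear_compose[OF matrix_vector_mul_linear P(1)] by (simp add: o_def)
  then have sub: "subspace (range ?f)" by (simp add: linear_subspace_image)
  have "range ?f = S"
  proof (rule ccontr)
    assume "range ?f \<noteq> S"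
    moreover have sp: "span (range ?f) = range ?f" "span S = S" using sub S by (simp_all add: span_eq_iff)
    ultimately have "span (range ?f) \<subset> span S" using P(2) unfolding sp by blast
    then obtain s where s: "s \<noteq> 0" "s \<in> S" "\<And>y. y \<in> range ?f \<Longrightarrow> orthogonal s y"
      using orthogonal_to_subspace_exists_gen[of "range ?f" S] unfolding sp by metis
    have "(transpose A *v s) \<bullet> w = 0" for w
    proof -
      have "s \<bullet> ?f w = 0" using s(3) by (auto simp: orthogonal_def)
      moreover have "(A *v w - ?f w) \<bullet> s = 0" by (rule P(3)[OF s(2)])
      moreover have "(transpose A *v s) \<bullet> w = (A *v w - ?f w) \<bullet> s + s \<bullet> ?f w"
        by (simp add: inner_transpose_matrix inner_diff_left inner_commute[of s])
      ultimately show ?thesis by simp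
    qed
    then have "transpose A *v s = 0" by (metis inner_eq_zero_iff)
    with inj s show False by blast
  qed
  then show ?thesis
    using linear_exists_right_inverse_on[OF lin subspace_UNIV] that by metis
qed

section \<open>Bounded multipliers under metric subregularity\<close>

lemma convergent_subsequence_of_bounded:
  fixes s :: "nat \<Rightarrow> 'a::heine_borel"
  assumes "bounded (range s)"
  obtains r l where "strict_mono (r :: nat \<Rightarrow> nat)" "(\<lambda>k. s (r k)) \<longlonglongrightarrow> l"
  using bounded_imp_convergent_subsequence[OF assms] by (auto simp: o_def)

locale polyhedral_constraint = twice_differentiable_map g J H
  for g :: "real ^ 'n \<Rightarrow> real ^ 's"
    and J :: "real ^ 'n \<Rightarrow> real ^ 'n ^ 's"
    and H :: "real ^ 's \<Rightarrow> real ^ 'n \<Rightarrow> real ^ 'n ^ 'n" +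
  fixes D :: "(real ^ 's) set"
    and \<Gamma> :: "(real ^ 'n) set"
    and \<Lambda> :: "(real ^ 'n) \<times> (real ^ 'n) \<Rightarrow> (real ^ 's) set"
    and F :: "(real ^ 'n) \<times> (real ^ 's) \<Rightarrow> ((real ^ 's) \<times> (real ^ 's)) set"
  assumes D: "polyhedron D"
    and \<Gamma>: "\<Gamma> = {x. g x \<in> D}"
    and \<Lambda>: "\<Lambda> = (\<lambda>(x, xs). {l \<in> limiting_normal_cone D (g x). transpose (J x) *v l = xs})"
    and F: "F = (\<lambda>(x, l). {(g x, l) - p | p. p \<in> gph (limiting_normal_cone D)})"
begin

text \<open>
  Metric subregularity of the constraint map at \<open>xbar\<close> gives this estimate at all points near \<open>xbar\<close> with
  one common constant, because it is an inequality on a whole neighbourhood. The common constant keeps the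
  multipliers bounded along sequences.
\<close>
definition error_bound :: "real \<Rightarrow> real ^ 'n \<Rightarrow> bool" where
  "error_bound \<kappa> x \<longleftrightarrow> 0 < \<kappa> \<and> (\<forall>\<^sub>F y in nhds x. infdist y \<Gamma> \<le> \<kappa> * infdist (g y) D)"

lemma \<Lambda>_iff: "l \<in> \<Lambda> (x, xs) \<longleftrightarrow> l \<in> limiting_normal_cone D (g x) \<and> transpose (J x) *v l = xs"
  by (simp add: \<Lambda>)

lemma convex_D: "convex D" and closed_D: "closed D"
  using D by (simp_all add: polyhedron_imp_convex polyhedron_imp_closed)

lemma continuous_on_map: "continuous_on UNIV g"
  by (intro continuous_at_imp_continuous_on ballI has_derivative_continuous[OF has_derivative_map])

lemma closed_\<Gamma>: "closed \<Gamma>"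
  unfolding \<Gamma> using continuous_on_closed_vimage[of UNIV g] continuous_on_map closed_D
  by (simp add: vimage_def)

lemma metrically_subregular_imp_error_bound:
  assumes "metrically_subregular (\<lambda>x. {g x - d | d. d \<in> D}) xbar 0"
  obtains \<kappa> where "\<forall>\<^sub>F x in nhds xbar. error_bound \<kappa> x"
proof -
  obtain \<kappa> U where k: "\<kappa> > 0" "open U" "xbar \<in> U"
    and est: "\<And>x. x \<in> U \<Longrightarrow> subregularity_estimate (\<lambda>x. {g x - d | d. d \<in> D}) 0 \<kappa> x"
    and ne: "D \<noteq> {}"
    using assms unfolding metrically_subregular_def gph_def by blast
  have "infdist y \<Gamma> \<le> \<kappa> * infdist (g y) D" if "y \<in> U" for y
  proof -
    have "{g y - d | d. d \<in> D} = (\<lambda>d. g y - d) ` D" by blast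
    then have "infdist 0 {g y - d | d. d \<in> D} = infdist (g y) D"
      by (simp add: infdist_def image_image dist_norm norm_minus_commute)
    moreover have "{x'. 0 \<in> {g x' - d | d. d \<in> D}} = \<Gamma>" by (auto simp: \<Gamma>)
    ultimately show ?thesis
      using est[OF that] ne by (auto simp: subregularity_estimate_def)
  qed
  then have "error_bound \<kappa> y" if "y \<in> U" for y
    using k that unfolding error_bound_def eventually_nhds by blast
  then have "\<forall>\<^sub>F x in nhds xbar. error_bound \<kappa> x" using k by (auto simp: eventually_nhds)
  then show ?thesis by (rule that)
qed

lemma normal_D: "l \<in> limiting_normal_cone D y \<longleftrightarrow> y \<in> D \<and> (\<forall>d\<in>D. l \<bullet> (d - y) \<le> 0)"
  by (rule limiting_normal_cone_convex[OF convex_D])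

lemma normal_D_limit:
  assumes "y \<longlonglongrightarrow> y0" "l \<longlonglongrightarrow> l0" "\<And>k::nat. l k \<in> limiting_normal_cone D (y k)"
  shows "l0 \<in> limiting_normal_cone D y0"
proof -
  have "(\<lambda>k. (y k, l k)) \<longlonglongrightarrow> (y0, l0)" by (intro tendsto_intros assms)
  from closed_sequentially[OF closed_gph_limiting_normal_cone[OF convex_D closed_D] _ this]
  show ?thesis using assms(3) by (simp add: gph_def)
qed

text \<open>
  The error bound linearises: scaled nearest points of \<open>\<Gamma>\<close> to \<open>x + t u\<close> stay bounded and accumulate at a
  tangent vector, whose distance to \<open>u\<close> is controlled by that of \<open>J x *v u\<close> to any tangent
  vector \<open>v\<close> of \<open>D\<close>.
\<close>
lemma tangent_approximation:
  assumes x: "x \<in> \<Gamma>" and eb: "error_bound \<kappa> x" and v: "v \<in> tangent_cone D (g x)"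
  obtains w where "w \<in> tangent_cone \<Gamma> x" "norm (w - u) \<le> \<kappa> * norm (J x *v u - v)"
proof -
  have gx: "g x \<in> D" using x by (simp add: \<Gamma>)
  have kpos: "\<kappa> > 0" using eb by (simp add: error_bound_def)
  define t where "t k = 1 / real (Suc k)" for k
  have t: "t k > 0" "t \<longlonglongrightarrow> 0" for k
    using LIMSEQ_inverse_real_of_nat by (simp_all add: t_def [abs_def] inverse_eq_divide del: of_nat_Suc)
  have tr: "filterlim t (at_right 0) sequentially" by (rule filterlim_at_right_zero_seq[OF t])
  have "\<exists>p\<in>\<Gamma>. infdist (x + t k *\<^sub>R u) \<Gamma> = dist (x + t k *\<^sub>R u) p" for k
    using infdist_attains_inf[OF closed_\<Gamma>, of "x + t k *\<^sub>R u"] x by blast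
  then obtain p where p: "\<And>k. p k \<in> \<Gamma>" "\<And>k. infdist (x + t k *\<^sub>R u) \<Gamma> = dist (x + t k *\<^sub>R u) (p k)"
    by metis
  define w where "w k = (p k - x) /\<^sub>R t k" for k
  define q where "q k = (g (x + t k *\<^sub>R u) - g x) /\<^sub>R t k" for k
  have q: "q \<longlonglongrightarrow> J x *v u"
    unfolding q_def [abs_def] by (rule map_quotient) (use t in auto)
  have xt: "(\<lambda>k. x + t k *\<^sub>R u) \<longlonglongrightarrow> x"
    using tendsto_add[OF tendsto_const tendsto_scaleR[OF t(2) tendsto_const], of x u] by simp
  have e1: "\<forall>\<^sub>F k in sequentially. infdist (x + t k *\<^sub>R u) \<Gamma> \<le> \<kappa> * infdist (g (x + t k *\<^sub>R u)) D"
    using eb xt by (auto simp: error_bound_def intro: eventually_compose_filterlim)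
  have e2: "\<forall>\<^sub>F k in sequentially. g x + t k *\<^sub>R v \<in> D"
    using eventually_compose_filterlim[OF tangent_cone_feasible[OF D gx v] tr] .
  have bound: "\<forall>\<^sub>F k in sequentially. norm (w k - u) \<le> \<kappa> * norm (q k - v)"
    using e1 e2
  proof eventually_elim
    case (elim k)
    have "dist (x + t k *\<^sub>R u) (p k) \<le> \<kappa> * infdist (g (x + t k *\<^sub>R u)) D" using elim p(2) by simp
    also have "\<dots> \<le> \<kappa> * dist (g (x + t k *\<^sub>R u)) (g x + t k *\<^sub>R v)"
      using elim kpos by (intro mult_left_mono infdist_le) auto
    finally have le: "dist (x + t k *\<^sub>R u) (p k) \<le> \<kappa> * dist (g (x + t k *\<^sub>R u)) (g x + t k *\<^sub>R v)" .
    have "x + t k *\<^sub>R u - p k = - (t k *\<^sub>R (w k - u))"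
      using t(1)[of k] by (simp add: w_def scaleR_diff_right)
    then have 1: "dist (x + t k *\<^sub>R u) (p k) = t k * norm (w k - u)"
      using t(1)[of k] by (simp add: dist_norm)
    have "g (x + t k *\<^sub>R u) - (g x + t k *\<^sub>R v) = t k *\<^sub>R (q k - v)"
      using t(1)[of k] by (simp add: q_def scaleR_diff_right)
    then have 2: "dist (g (x + t k *\<^sub>R u)) (g x + t k *\<^sub>R v) = t k * norm (q k - v)"
      using t(1)[of k] by (simp add: dist_norm)
    from le t(1)[of k] show ?case unfolding 1 2 by (simp add: mult.left_commute[of \<kappa>])
  qed
  then obtain N where N: "\<And>k. k \<ge> N \<Longrightarrow> norm (w k - u) \<le> \<kappa> * norm (q k - v)"
    by (auto simp: eventually_sequentially)
  have "bounded (range (\<lambda>k. q (k + N)))"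
    using LIMSEQ_ignore_initial_segment[OF q] convergent_imp_bounded by (blast intro: convergentI)
  then obtain M where M: "\<And>k. norm (q (k + N)) \<le> M" by (auto simp: bounded_iff)
  have "norm (w (k + N)) \<le> norm u + \<kappa> * (M + norm v)" for k
  proof -
    have "norm (w (k + N)) \<le> norm u + norm (w (k + N) - u)" using norm_triangle_sub by blast
    also have "\<dots> \<le> norm u + \<kappa> * norm (q (k + N) - v)" using N[of "k + N"] by simp
    also have "\<dots> \<le> norm u + \<kappa> * (M + norm v)"
      using kpos M[of k] norm_triangle_ineq4[of "q (k + N)" v] by simp
    finally show ?thesis .
  qed
  then have "bounded (range (\<lambda>k. w (k + N)))" by (auto simp: bounded_iff)
  then obtain r w0 where r: "strict_mono (r :: nat \<Rightarrow> nat)" "(\<lambda>k. w (r k + N)) \<longlonglongrightarrow> w0"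
    by (rule convergent_subsequence_of_bounded)
  have sub: "(\<lambda>k. f (r k + N)) \<longlonglongrightarrow> l" if "f \<longlonglongrightarrow> l" for f :: "nat \<Rightarrow> 'b::metric_space" and l
    using LIMSEQ_subseq_LIMSEQ[OF LIMSEQ_ignore_initial_segment[OF that, of N] r(1)] by (simp add: o_def)
  have "w0 \<in> tangent_cone \<Gamma> x"
    unfolding tangent_cone_def
  proof (intro CollectI conjI exI allI)
    show "x + t (r k + N) *\<^sub>R w (r k + N) \<in> \<Gamma>" for k
      using p(1)[of "r k + N"] t(1)[of "r k + N"] by (simp add: w_def)
  qed (use x t r(2) sub[OF t(2)] in auto)
  moreover have "norm (w0 - u) \<le> \<kappa> * norm (J x *v u - v)"
  proof (rule LIMSEQ_le)
    show "(\<lambda>k. norm (w (r k + N) - u)) \<longlonglongrightarrow> norm (w0 - u)" by (intro tendsto_intros r(2))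
    show "(\<lambda>k. \<kappa> * norm (q (r k + N) - v)) \<longlonglongrightarrow> \<kappa> * norm (J x *v u - v)"
      by (intro tendsto_intros sub[OF q])
    show "\<exists>M. \<forall>k\<ge>M. norm (w (r k + N) - u) \<le> \<kappa> * norm (q (r k + N) - v)" using N by auto
  qed
  ultimately show ?thesis using that by blast
qed

lemma jacobian_maps_tangent:
  assumes "w \<in> tangent_cone \<Gamma> x"
  shows "J x *v w \<in> tangent_cone D (g x)"
proof -
  obtain t v where t: "\<And>k::nat. t k > (0::real)" "t \<longlonglongrightarrow> 0" "v \<longlonglongrightarrow> w" "\<And>k. x + t k *\<^sub>R v k \<in> \<Gamma>" "x \<in> \<Gamma>"
    using assms unfolding tangent_cone_def by blast
  have "(\<lambda>k. (g (x + t k *\<^sub>R v k) - g x) /\<^sub>R t k) \<longlonglongrightarrow> J x *v w"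
    by (rule map_quotient) (use t in auto)
  moreover have "g x + t k *\<^sub>R ((g (x + t k *\<^sub>R v k) - g x) /\<^sub>R t k) \<in> D" for k
    using t(1)[of k] t(4)[of k] by (simp add: \<Gamma>)
  ultimately show ?thesis
    unfolding tangent_cone_def mem_Collect_eq using t(1,2,5) unfolding \<Gamma> by blast
qed

lemma tangent_cone_\<Gamma>:
  assumes "x \<in> \<Gamma>" "error_bound \<kappa> x"
  shows "tangent_cone \<Gamma> x = {u. J x *v u \<in> tangent_cone D (g x)}"
proof (intro set_eqI iffI)
  fix u assume "u \<in> {u. J x *v u \<in> tangent_cone D (g x)}"
  then obtain w where "w \<in> tangent_cone \<Gamma> x" "norm (w - u) \<le> \<kappa> * norm (J x *v u - J x *v u)"
    using tangent_approximation[OF assms, of "J x *v u" u] by blast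
  then show "u \<in> tangent_cone \<Gamma> x" by simp
qed (use jacobian_maps_tangent in auto)

lemma adjoint_normal_regular:
  assumes "l \<in> limiting_normal_cone D (g x)"
  shows "transpose (J x) *v l \<in> regular_normal_cone \<Gamma> x"
proof -
  have gx: "g x \<in> D" using assms by (simp add: normal_D)
  then show ?thesis
    using assms jacobian_maps_tangent limiting_normal_cone_polyhedron_polar[OF D gx]
    by (auto simp: regular_normal_cone_def negative_polar_def \<Gamma> inner_transpose_matrix)
qed

lemma adjoint_normal:
  assumes "l \<in> limiting_normal_cone D (g x)"
  shows "transpose (J x) *v l \<in> limiting_normal_cone \<Gamma> x"
  using adjoint_normal_regular[OF assms] regular_subset_limiting by blast

text \<open>
  The images of the multipliers of norm at most \<open>\<kappa> * norm xs\<close> form a compact convex set. If \<open>xs\<close> were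
  outside, a separating direction \<open>u\<close> would violate the linearised error bound: on \<open>u\<close>, the best
  multiplier is the scaled residual of \<open>J x *v u\<close> after projection to the tangent cone of \<open>D\<close>,
  and it already reaches the value that the error bound allows for \<open>xs \<bullet> u\<close>.
\<close>
lemma bounded_multiplier_regular:
  assumes x: "x \<in> \<Gamma>" and eb: "error_bound \<kappa> x" and xs: "xs \<in> regular_normal_cone \<Gamma> x"
  shows "\<exists>l\<in>\<Lambda> (x, xs). norm l \<le> \<kappa> * norm xs"
proof (rule ccontr)
  assume neg: "\<not> ?thesis"
  have gx: "g x \<in> D" using x by (simp add: \<Gamma>)
  let ?T = "tangent_cone D (g x)" and ?N = "limiting_normal_cone D (g x)"
  let ?c = "\<kappa> * norm xs"
  have T: "convex ?T" "closed ?T"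
    using polyhedron_tangent_cone[OF D gx] polyhedron_imp_convex polyhedron_imp_closed by auto
  have c0: "?c \<ge> 0" using eb by (simp add: error_bound_def)
  define S where "S = (*v) (transpose (J x)) ` (?N \<inter> cball 0 ?c)"
  have N: "?N = (\<Inter>d\<in>D. {l. l \<bullet> (d - g x) \<le> 0})" using gx by (auto simp: normal_D)
  have "closed ?N" unfolding N by (intro closed_INT ballI closed_Collect_le continuous_intros)
  then have "compact (?N \<inter> cball 0 ?c)" by (simp add: closed_Int_compact)
  moreover have "continuous_on (?N \<inter> cball 0 ?c) ((*v) (transpose (J x)))"
    by (intro linear_continuous_on linear_conv_bounded_linear[THEN iffD1] matrix_vector_mul_linear)
  ultimately have clS: "closed S" unfolding S_def by (intro compact_imp_closed compact_continuous_image) auto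
  have "convex ?N" unfolding N
    by (intro convex_INT ballI) (simp add: inner_commute[of _ "_ - _"] convex_halfspace_le)
  then have cvS: "convex S" unfolding S_def by (intro convex_linear_image convex_Int convex_cball) auto
  have "xs \<notin> S" using neg by (auto simp: S_def \<Lambda>_iff)
  then obtain a b where ab: "a \<bullet> xs < b" "\<And>s. s \<in> S \<Longrightarrow> a \<bullet> s > b"
    using separating_hyperplane_closed_point[OF cvS clS] by blast
  define u where "u = - a"
  obtain p where p: "p \<in> ?T" "infdist (J x *v u) ?T = dist (J x *v u) p"
    using infdist_attains_inf[OF T(2)] gx
    by (metis (no_types, lifting) empty_iff tangent_coneI_feasible[OF convex_D gx gx])
  define n where "n = J x *v u - p"
  have "n \<bullet> (y - p) \<le> 0" if "y \<in> ?T" for y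
    unfolding n_def using p that infdist_le
    by (intro any_closest_point_dot[OF T]) (auto simp: p(2)[symmetric])
  then have "n \<in> limiting_normal_cone ?T p"
    using p(1) by (simp add: limiting_normal_cone_convex[OF T(1)])
  then have n: "n \<in> ?N" "n \<bullet> p = 0" by (simp_all add: limiting_normal_cone_tangent[OF D gx])
  obtain w where w: "w \<in> tangent_cone \<Gamma> x" "norm (w - u) \<le> \<kappa> * norm n"
    using tangent_approximation[OF x eb p(1), of u] unfolding n_def by blast
  have "xs \<bullet> w \<le> 0" using xs w(1) x by (simp add: regular_normal_cone_def negative_polar_def)
  then have "xs \<bullet> u \<le> xs \<bullet> (u - w)" by (simp add: inner_simps)
  also have "\<dots> \<le> norm xs * norm (u - w)" by (rule norm_cauchy_schwarz)
  also have "\<dots> \<le> norm xs * (\<kappa> * norm n)" using w(2) by (intro mult_left_mono) (auto simp: norm_minus_commute)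
  finally have upper: "xs \<bullet> u \<le> ?c * norm n" by (simp add: mult_ac)
  \<comment> \<open>For \<open>n = 0\<close> division by zero makes \<open>l = 0\<close>, which is the right multiplier in that case too.\<close>
  define l where "l = (?c / norm n) *\<^sub>R n"
  have lN: "l \<in> ?N"
  proof -
    have "l \<bullet> (d - g x) \<le> 0" if "d \<in> D" for d
    proof -
      have "n \<bullet> (d - g x) \<le> 0" using n(1) that by (simp add: normal_D)
      then have "(?c / norm n) * (n \<bullet> (d - g x)) \<le> 0" using c0 by (intro mult_nonneg_nonpos) auto
      then show ?thesis by (simp only: l_def inner_scaleR_left)
    qed
    then show ?thesis using gx by (simp add: normal_D)
  qed
  have "norm l \<le> ?c" using c0 by (simp add: l_def)
  with lN have "transpose (J x) *v l \<in> S" by (auto simp: S_def)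
  then have "a \<bullet> (transpose (J x) *v l) > b" by (rule ab(2))
  then have "(transpose (J x) *v l) \<bullet> u < - b" by (simp add: u_def inner_commute)
  then have "l \<bullet> (J x *v u) < - b" by (simp only: inner_transpose_matrix)
  moreover have "n \<bullet> (J x *v u) = n \<bullet> n" using n(2) by (simp add: n_def inner_simps)
  then have "l \<bullet> (J x *v u) = ?c * norm n"
    by (cases "n = 0") (simp_all add: l_def power2_norm_eq_inner[symmetric] power2_eq_square)
  ultimately show False using upper ab(1) by (simp add: u_def inner_commute)
qed

text \<open>
  Without the norm bound the multipliers of approximating regular normals could diverge; with it they
  subconverge, and the graph of the normal cone map of \<open>D\<close> is closed.
\<close>
lemma bounded_multiplier_limiting:
  assumes eb: "\<forall>\<^sub>F y in nhds x. error_bound \<kappa> y" and xs: "xs \<in> limiting_normal_cone \<Gamma> x"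
  shows "\<exists>l\<in>\<Lambda> (x, xs). norm l \<le> \<kappa> * norm xs"
proof -
  obtain y ys where y: "y \<longlonglongrightarrow> x" "ys \<longlonglongrightarrow> xs" "\<And>k::nat. ys k \<in> regular_normal_cone \<Gamma> (y k)"
    using xs unfolding limiting_normal_cone_def by blast
  have "\<forall>\<^sub>F k in sequentially. error_bound \<kappa> (y k)" using eventually_compose_filterlim[OF eb y(1)] .
  then have "\<forall>\<^sub>F k in sequentially. \<exists>l\<in>\<Lambda> (y k, ys k). norm l \<le> \<kappa> * norm (ys k)"
  proof (rule eventually_mono)
    fix k assume eb: "error_bound \<kappa> (y k)"
    have "y k \<in> \<Gamma>" using y(3)[of k] by (simp add: regular_normal_cone_def split: if_splits)
    from bounded_multiplier_regular[OF this eb y(3)]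
    show "\<exists>l\<in>\<Lambda> (y k, ys k). norm l \<le> \<kappa> * norm (ys k)" .
  qed
  then obtain N where "\<And>k. k \<ge> N \<Longrightarrow> \<exists>l\<in>\<Lambda> (y k, ys k). norm l \<le> \<kappa> * norm (ys k)"
    by (auto simp: eventually_sequentially)
  then have "\<exists>l\<in>\<Lambda> (y (k + N), ys (k + N)). norm l \<le> \<kappa> * norm (ys (k + N))" for k by simp
  then obtain l where l: "\<And>k. l k \<in> \<Lambda> (y (k + N), ys (k + N))" "\<And>k. norm (l k) \<le> \<kappa> * norm (ys (k + N))"
    by metis
  have kpos: "\<kappa> > 0" using eventually_nhds_x_imp_x[OF eb] by (simp add: error_bound_def)
  obtain M where M: "\<And>k. norm (ys k) \<le> M"
    using convergent_imp_bounded[OF y(2)] by (auto simp: bounded_iff)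
  have "norm (l k) \<le> \<kappa> * M" for k
    using l(2)[of k] M[of "k + N"] kpos by (meson mult_left_mono order_trans less_imp_le)
  then have "bounded (range l)" by (auto simp: bounded_iff)
  then obtain r l0 where r: "strict_mono (r :: nat \<Rightarrow> nat)" "(\<lambda>k. l (r k)) \<longlonglongrightarrow> l0"
    by (rule convergent_subsequence_of_bounded)
  have y': "(\<lambda>k. y (r k + N)) \<longlonglongrightarrow> x" "(\<lambda>k. ys (r k + N)) \<longlonglongrightarrow> xs"
    using LIMSEQ_subseq_LIMSEQ[OF LIMSEQ_ignore_initial_segment[OF y(1), of N] r(1)]
      LIMSEQ_subseq_LIMSEQ[OF LIMSEQ_ignore_initial_segment[OF y(2), of N] r(1)] by (simp_all add: o_def)
  have "l0 \<in> limiting_normal_cone D (g x)"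
    by (rule normal_D_limit[OF tendsto_map[OF y'(1)] r(2)]) (use l(1) in \<open>auto simp: \<Lambda>_iff\<close>)
  moreover have "transpose (J x) *v l0 = xs"
  proof (rule LIMSEQ_unique)
    show "(\<lambda>k. transpose (J (y (r k + N))) *v l (r k)) \<longlonglongrightarrow> transpose (J x) *v l0"
      by (rule tendsto_jacobian_transpose[OF y'(1) r(2)])
    show "(\<lambda>k. transpose (J (y (r k + N))) *v l (r k)) \<longlonglongrightarrow> xs"
      using l(1) y'(2) by (simp add: \<Lambda>_iff)
  qed
  moreover have "norm l0 \<le> \<kappa> * norm xs"
  proof (rule LIMSEQ_le)
    show "(\<lambda>k. norm (l (r k))) \<longlonglongrightarrow> norm l0" "(\<lambda>k. \<kappa> * norm (ys (r k + N))) \<longlonglongrightarrow> \<kappa> * norm xs"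
      by (intro tendsto_intros r y')+
  qed (use l(2) in auto)
  ultimately show ?thesis by (auto simp: \<Lambda>_iff)
qed

section \<open>The graphical derivative of the normal cone map\<close>

text \<open>
  The critical cone of \<open>\<Gamma>\<close> is the preimage under the Jacobian of the critical cone of \<open>D\<close>, whichever multiplier
  \<open>l\<close> is chosen, because \<open>xs \<bullet> w = l \<bullet> (J x *v w)\<close>.
\<close>
lemma normal_cone_critical_cone_\<Gamma>:
  assumes x: "x \<in> \<Gamma>" and eb: "error_bound \<kappa> x" and l: "l \<in> \<Lambda> (x, xs)"
  shows "limiting_normal_cone (critical_cone \<Gamma> x xs) u =
    (*v) (transpose (J x)) ` limiting_normal_cone (critical_cone D (g x) l) (J x *v u)"
proof -
  have gx: "g x \<in> D" using x by (simp add: \<Gamma>)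
  have "critical_cone \<Gamma> x xs = {u. J x *v u \<in> critical_cone D (g x) l}"
    using l by (auto simp: critical_cone_def tangent_cone_\<Gamma>[OF x eb] \<Lambda>_iff inner_transpose_matrix[symmetric])
  then show ?thesis
    using limiting_normal_cone_linear_preimage[OF polyhedron_critical_cone[OF D gx]] by simp
qed

text \<open>
  This is the common core of both upper estimates. Bounded multipliers along a sequence in the graph
  subconverge, and their difference quotients obey the conditions of the polyhedral normal cone map;
  the quotients themselves need not converge, only their images under the transposed Jacobian do.
\<close>
lemma multiplier_subsequence:
  assumes eb: "\<forall>\<^sub>F y in nhds x. error_bound \<kappa> y"
    and t: "\<And>k::nat. t k > (0::real)" "t \<longlonglongrightarrow> 0" and u: "u \<longlonglongrightarrow> u0" and us: "us \<longlonglongrightarrow> us0"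
    and mem: "\<And>k. xs + t k *\<^sub>R us k \<in> limiting_normal_cone \<Gamma> (x + t k *\<^sub>R u k)"
  obtains r :: "nat \<Rightarrow> nat" and l l0 where "strict_mono r" "l \<longlonglongrightarrow> l0" "l0 \<in> \<Lambda> (x, xs)"
    "\<And>k. l k \<in> \<Lambda> (x + t (r k) *\<^sub>R u (r k), xs + t (r k) *\<^sub>R us (r k))"
    "l0 \<in> limiting_normal_cone (tangent_cone D (g x)) (J x *v u0)"
    "\<And>k. limiting_normal_cone D (g (x + t (r k) *\<^sub>R u (r k)))
       \<subseteq> limiting_normal_cone (tangent_cone D (g x)) (J x *v u0)"
    "\<And>k. (l k - l0) /\<^sub>R t (r k) \<in> limiting_normal_cone (critical_cone D (g x) l0) (J x *v u0)"
    "(\<lambda>k. transpose (J x) *v ((l k - l0) /\<^sub>R t (r k))) \<longlonglongrightarrow> us0 - H l0 x *v u0"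
proof -
  define X where "X k = x + t k *\<^sub>R u k" for k
  define XS where "XS k = xs + t k *\<^sub>R us k" for k
  have X: "X \<longlonglongrightarrow> x"
    using tendsto_add[OF tendsto_const tendsto_scaleR[OF t(2) u], of x] by (simp add: X_def [abs_def])
  have XS: "XS \<longlonglongrightarrow> xs"
    using tendsto_add[OF tendsto_const tendsto_scaleR[OF t(2) us], of xs] by (simp add: XS_def [abs_def])
  have memX: "XS k \<in> limiting_normal_cone \<Gamma> (X k)" for k using mem by (simp add: X_def XS_def)
  then have gX: "g (X k) \<in> D" for k by (simp add: limiting_normal_cone_def \<Gamma>)
  have gx: "g x \<in> D"
    using closed_sequentially[OF closed_D _ tendsto_map[OF X]] gX by blast
  define v where "v k = (g (X k) - g x) /\<^sub>R t k" for k
  have v: "v \<longlonglongrightarrow> J x *v u0" unfolding v_def [abs_def] X_def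
    by (rule map_quotient) (use t u in auto)
  have vX: "g x + t k *\<^sub>R v k = g (X k)" for k using t(1)[of k] by (simp add: v_def)
  have near: "\<forall>\<^sub>F k in sequentially. limiting_normal_cone D (g (X k))
      \<subseteq> limiting_normal_cone (tangent_cone D (g x)) (J x *v u0)"
    using normal_cone_near_direction[OF D gx t v] vX gX by simp
  have "\<forall>\<^sub>F y in nhds x. \<forall>\<^sub>F z in nhds y. error_bound \<kappa> z" using eb by (simp add: eventually_eventually)
  then have eb2: "\<forall>\<^sub>F k in sequentially. \<forall>\<^sub>F z in nhds (X k). error_bound \<kappa> z"
    using X by (rule eventually_compose_filterlim)
  have "\<forall>\<^sub>F k in sequentially. limiting_normal_cone D (g (X k))
      \<subseteq> limiting_normal_cone (tangent_cone D (g x)) (J x *v u0) \<and>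
     (\<exists>l\<in>\<Lambda> (X k, XS k). norm l \<le> \<kappa> * norm (XS k))"
    using near eb2
  proof eventually_elim
    case (elim k)
    show ?case
      using elim(1) bounded_multiplier_limiting[OF elim(2) memX] by blast
  qed
  then obtain N where N: "\<And>k. k \<ge> N \<Longrightarrow> limiting_normal_cone D (g (X k))
      \<subseteq> limiting_normal_cone (tangent_cone D (g x)) (J x *v u0) \<and>
     (\<exists>l\<in>\<Lambda> (X k, XS k). norm l \<le> \<kappa> * norm (XS k))"
    by (auto simp: eventually_sequentially)
  then have "\<exists>l\<in>\<Lambda> (X (k + N), XS (k + N)). norm l \<le> \<kappa> * norm (XS (k + N))" for k by simp
  then obtain m where m: "\<And>k. m k \<in> \<Lambda> (X (k + N), XS (k + N))" "\<And>k. norm (m k) \<le> \<kappa> * norm (XS (k + N))"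
    by metis
  have kpos: "\<kappa> > 0" using eventually_nhds_x_imp_x[OF eb] by (simp add: error_bound_def)
  obtain M where M: "\<And>k. norm (XS k) \<le> M"
    using convergent_imp_bounded[OF XS] by (auto simp: bounded_iff)
  have "norm (m k) \<le> \<kappa> * M" for k
    using m(2)[of k] M[of "k + N"] kpos by (meson mult_left_mono order_trans less_imp_le)
  then have "bounded (range m)" by (auto simp: bounded_iff)
  then obtain r' l0 where r': "strict_mono (r' :: nat \<Rightarrow> nat)" "(\<lambda>k. m (r' k)) \<longlonglongrightarrow> l0"
    by (rule convergent_subsequence_of_bounded)
  define r where "r k = r' k + N" for k
  define l where "l k = m (r' k)" for k
  have r: "strict_mono r" using r'(1) by (simp add: r_def strict_mono_def)
  have sub: "(\<lambda>k. f (r k)) \<longlonglongrightarrow> a" if "f \<longlonglongrightarrow> a" for f :: "nat \<Rightarrow> 'b::metric_space" and a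
    using LIMSEQ_subseq_LIMSEQ[OF that r] by (simp add: o_def)
  have l: "l \<longlonglongrightarrow> l0" using r'(2) by (simp add: l_def [abs_def])
  have lL: "l k \<in> \<Lambda> (X (r k), XS (r k))" for k using m(1)[of "r' k"] by (simp add: l_def r_def)
  have nearr: "limiting_normal_cone D (g (X (r k)))
      \<subseteq> limiting_normal_cone (tangent_cone D (g x)) (J x *v u0)" for k
    using N[of "r k"] by (simp add: r_def)
  have l0N: "l0 \<in> limiting_normal_cone D (g x)"
    by (rule normal_D_limit[OF tendsto_map[OF sub[OF X]] l]) (use lL in \<open>auto simp: \<Lambda>_iff\<close>)
  have l0xs: "transpose (J x) *v l0 = xs"
  proof (rule LIMSEQ_unique)
    show "(\<lambda>k. transpose (J (X (r k))) *v l k) \<longlonglongrightarrow> transpose (J x) *v l0"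
      by (rule tendsto_jacobian_transpose[OF sub[OF X] l])
    show "(\<lambda>k. transpose (J (X (r k))) *v l k) \<longlonglongrightarrow> xs"
      using lL sub[OF XS] by (simp add: \<Lambda>_iff)
  qed
  have lT: "l k \<in> limiting_normal_cone (tangent_cone D (g x)) (J x *v u0)" for k
    using nearr lL by (auto simp: \<Lambda>_iff)
  then have lk: "J x *v u0 \<in> tangent_cone D (g x)" "l k \<bullet> (J x *v u0) = 0"
    "\<And>w. w \<in> tangent_cone D (g x) \<Longrightarrow> l k \<bullet> w \<le> 0" for k
    using limiting_normal_cone_tangent[OF D gx] limiting_normal_cone_polyhedron_polar[OF D gx] by auto
  have "(\<lambda>k. l k \<bullet> (J x *v u0)) \<longlonglongrightarrow> l0 \<bullet> (J x *v u0)" by (intro tendsto_intros l)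
  then have l0v: "l0 \<bullet> (J x *v u0) = 0" using lk(2) by (simp add: LIMSEQ_const_iff)
  have eta: "(l k - l0) /\<^sub>R t (r k) \<in> limiting_normal_cone (critical_cone D (g x) l0) (J x *v u0)" for k
    unfolding limiting_normal_cone_critical[OF D gx]
    using lk l0v t(1)[of "r k"]
    by (auto simp: critical_cone_def inner_diff_left intro!: mult_nonneg_nonpos)
  have "(\<lambda>k. us (r k) - (transpose (J (x + t (r k) *\<^sub>R u (r k))) *v l k - transpose (J x) *v l k) /\<^sub>R t (r k))
      \<longlonglongrightarrow> us0 - H l0 x *v u0"
    by (intro tendsto_diff sub[OF us] jacobian_transpose_quotient l sub[OF t(2)] sub[OF u])
       (use t(1) in auto)
  moreover have "us (r k) - (transpose (J (x + t (r k) *\<^sub>R u (r k))) *v l k - transpose (J x) *v l k) /\<^sub>R t (r k)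
      = transpose (J x) *v ((l k - l0) /\<^sub>R t (r k))" for k
  proof -
    have "transpose (J (x + t (r k) *\<^sub>R u (r k))) *v l k = xs + t (r k) *\<^sub>R us (r k)"
      using lL[of k] by (simp add: \<Lambda>_iff X_def XS_def)
    then show ?thesis
      using t(1)[of "r k"] l0xs
      by (simp add: matrix_vector_mult_scaleR matrix_vector_mult_diff_distrib algebra_simps)
  qed
  ultimately have lim: "(\<lambda>k. transpose (J x) *v ((l k - l0) /\<^sub>R t (r k))) \<longlonglongrightarrow> us0 - H l0 x *v u0"
    by simp
  show ?thesis
    using that[OF r l] l0N l0xs lL lk(1) l0v nearr eta lim
    by (simp add: \<Lambda>_iff X_def XS_def limiting_normal_cone_tangent[OF D gx])
qed

lemma graphical_derivative_subset:
  assumes eb: "\<forall>\<^sub>F y in nhds x. error_bound \<kappa> y"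
    and us: "us \<in> graphical_derivative (limiting_normal_cone \<Gamma>) (x, xs) u"
  shows "\<exists>l\<in>\<Lambda> (x, xs). \<exists>\<mu>\<in>limiting_normal_cone (critical_cone D (g x) l) (J x *v u).
    us = H l x *v u + transpose (J x) *v \<mu>"
proof -
  from us obtain t p where t: "\<And>k::nat. t k > (0::real)" "t \<longlonglongrightarrow> 0" and p: "p \<longlonglongrightarrow> (u, us)"
    and mem: "\<And>k. (x, xs) + t k *\<^sub>R p k \<in> gph (limiting_normal_cone \<Gamma>)"
    unfolding graphical_derivative_def tangent_cone_def by blast
  have lim: "(\<lambda>k. fst (p k)) \<longlonglongrightarrow> u" "(\<lambda>k. snd (p k)) \<longlonglongrightarrow> us"
    using tendsto_fst[OF p] tendsto_snd[OF p] by simp_all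
  have N: "xs + t k *\<^sub>R snd (p k) \<in> limiting_normal_cone \<Gamma> (x + t k *\<^sub>R fst (p k))" for k
    using mem[of k] by (simp add: gph_def plus_prod_def case_prod_beta)
  obtain r :: "nat \<Rightarrow> nat" and l l0 where l0: "l0 \<in> \<Lambda> (x, xs)"
    and eta: "\<And>k. (l k - l0) /\<^sub>R t (r k) \<in> limiting_normal_cone (critical_cone D (g x) l0) (J x *v u)"
    and conv: "(\<lambda>k. transpose (J x) *v ((l k - l0) /\<^sub>R t (r k))) \<longlonglongrightarrow> us - H l0 x *v u"
    by (rule multiplier_subsequence[OF eb t lim N], rule that)
  have gx: "g x \<in> D" using l0 by (simp add: \<Lambda>_iff normal_D)
  \<comment> \<open>The quotients may diverge, so the limit is taken in the closed image of the normal cone.\<close>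
  have "us - H l0 x *v u \<in> (*v) (transpose (J x)) ` limiting_normal_cone (critical_cone D (g x) l0) (J x *v u)"
    by (rule closed_sequentially[OF closed_linear_image_normal_cone[OF polyhedron_critical_cone[OF D gx]] _ conv])
       (use eta in blast)
  then show ?thesis using l0 by (force simp: algebra_simps)
qed

lemma F_inverse: "{p. (0, 0) \<in> F p} = {(x, l). l \<in> limiting_normal_cone D (g x)}"
  by (auto simp: F gph_def)

lemma infdist_F: "infdist (0, 0) (F (x, l)) = infdist (g x, l) (gph (limiting_normal_cone D))"
proof -
  have "F (x, l) = (\<lambda>p. (g x, l) - p) ` gph (limiting_normal_cone D)"
    unfolding F case_prod_conv by (rule Setcompr_eq_image)
  then show ?thesis
    by (simp add: infdist_def image_image dist_norm zero_prod_def[symmetric] norm_minus_commute)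
qed

lemma gph_normal_D_nonempty:
  assumes "y \<in> D" shows "gph (limiting_normal_cone D) \<noteq> {}"
proof -
  have "(y, 0) \<in> gph (limiting_normal_cone D)" using assms by (simp add: gph_def normal_D)
  then show ?thesis by blast
qed

lemma subregularity_estimate_F:
  assumes "y \<in> D"
  shows "subregularity_estimate F (0, 0) \<kappa> (x, l) \<longleftrightarrow>
    infdist (x, l) {(x, l). l \<in> limiting_normal_cone D (g x)} \<le> \<kappa> * infdist (g x, l) (gph (limiting_normal_cone D))"
  using gph_normal_D_nonempty[OF assms]
  by (auto simp: subregularity_estimate_def F_inverse infdist_F) (auto simp: F)

lemma closed_F_inverse: "closed {(x, l). l \<in> limiting_normal_cone D (g x)}"
proof -
  have "{(x, l). l \<in> limiting_normal_cone D (g x)} =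
      (\<lambda>p. (g (fst p), snd p)) -` gph (limiting_normal_cone D)" by (auto simp: gph_def)
  moreover have "continuous_on UNIV (\<lambda>p. (g (fst p), snd p))"
    by (intro continuous_intros continuous_on_compose2[OF continuous_on_map]) auto
  ultimately show ?thesis
    using continuous_on_closed_vimage[of UNIV "\<lambda>p. (g (fst p), snd p)"]
      closed_gph_limiting_normal_cone[OF convex_D closed_D] by auto
qed

text \<open>
  The residual of \<open>(x + t u, l + t \<eta>)\<close> is the linearisation error of \<open>g\<close>, because
  \<open>(g x + t (J x *v u), l + t \<eta>)\<close> lies in the graph for small \<open>t\<close>. Subregularity then yields points
  \<open>p k\<close> satisfying the graph condition exactly, within \<open>o(t)\<close>.
\<close>
lemma graphical_derivative_superset:
  assumes l: "l \<in> \<Lambda> (x, xs)"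
    and eta: "\<eta> \<in> limiting_normal_cone (critical_cone D (g x) l) (J x *v u)"
    and sr: "dir_metrically_subregular F (x, l) (0, 0) (u, \<eta>)"
  shows "H l x *v u + transpose (J x) *v \<eta> \<in> graphical_derivative (limiting_normal_cone \<Gamma>) (x, xs) u"
proof -
  have lN: "l \<in> limiting_normal_cone D (g x)" and lxs: "transpose (J x) *v l = xs" using l by (auto simp: \<Lambda>_iff)
  have gx: "g x \<in> D" using lN by (simp add: normal_D)
  define t where "t k = 1 / real (Suc k)" for k
  have t: "t k > 0" "t \<longlonglongrightarrow> 0" for k
    using LIMSEQ_inverse_real_of_nat by (simp_all add: t_def [abs_def] inverse_eq_divide del: of_nat_Suc)
  have tr: "filterlim t (at_right 0) sequentially" by (rule filterlim_at_right_zero_seq[OF t])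
  obtain \<kappa> where k: "\<kappa> > 0"
    and all: "\<And>t v. \<lbrakk>\<forall>k::nat. t k > (0::real); t \<longlonglongrightarrow> 0; v \<longlonglongrightarrow> (u, \<eta>)\<rbrakk> \<Longrightarrow>
        \<forall>\<^sub>F k in sequentially. subregularity_estimate F (0, 0) \<kappa> ((x, l) + t k *\<^sub>R v k)"
    using sr unfolding dir_metrically_subregular_def by blast
  have "\<forall>\<^sub>F k in sequentially. subregularity_estimate F (0, 0) \<kappa> ((x, l) + t k *\<^sub>R (u, \<eta>))"
    by (rule all) (use t in auto)
  then have est: "\<forall>\<^sub>F k in sequentially. infdist (x + t k *\<^sub>R u, l + t k *\<^sub>R \<eta>) {(x, l). l \<in> limiting_normal_cone D (g x)}
     \<le> \<kappa> * infdist (g (x + t k *\<^sub>R u), l + t k *\<^sub>R \<eta>) (gph (limiting_normal_cone D))"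
    by (simp add: subregularity_estimate_F[OF gx])
  have step: "\<forall>\<^sub>F k in sequentially. l + t k *\<^sub>R \<eta> \<in> limiting_normal_cone D (g x + t k *\<^sub>R (J x *v u))"
    using eventually_compose_filterlim[OF normal_cone_graph_step[OF D gx lN eta] tr] .
  have ne: "{(x, l). l \<in> limiting_normal_cone D (g x)} \<noteq> {}" using lN by blast
  have "\<exists>p. snd p \<in> limiting_normal_cone D (g (fst p)) \<and>
     infdist (x + t k *\<^sub>R u, l + t k *\<^sub>R \<eta>) {(x, l). l \<in> limiting_normal_cone D (g x)} = dist (x + t k *\<^sub>R u, l + t k *\<^sub>R \<eta>) p" for k
    using infdist_attains_inf[OF closed_F_inverse ne, of "(x + t k *\<^sub>R u, l + t k *\<^sub>R \<eta>)"]
    by (metis (mono_tags, lifting) case_prod_unfold mem_Collect_eq)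
  then obtain p where p: "\<And>k. snd (p k) \<in> limiting_normal_cone D (g (fst (p k)))"
    "\<And>k. infdist (x + t k *\<^sub>R u, l + t k *\<^sub>R \<eta>) {(x, l). l \<in> limiting_normal_cone D (g x)} = dist (x + t k *\<^sub>R u, l + t k *\<^sub>R \<eta>) (p k)"
    by metis
  define w where "w k = (p k - (x, l)) /\<^sub>R t k" for k
  have pw: "p k = (x + t k *\<^sub>R fst (w k), l + t k *\<^sub>R snd (w k))" for k
    using t(1)[of k] by (simp add: w_def prod_eq_iff)
  define q where "q k = (g (x + t k *\<^sub>R u) - g x) /\<^sub>R t k" for k
  have q: "q \<longlonglongrightarrow> J x *v u"
    unfolding q_def [abs_def] by (rule map_quotient) (use t in auto)
  have bound: "\<forall>\<^sub>F k in sequentially. norm (w k - (u, \<eta>)) \<le> \<kappa> * norm (q k - J x *v u)"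
    using est step
  proof eventually_elim
    case (elim k)
    have "dist (x + t k *\<^sub>R u, l + t k *\<^sub>R \<eta>) (p k) \<le>
       \<kappa> * dist (g (x + t k *\<^sub>R u), l + t k *\<^sub>R \<eta>) (g x + t k *\<^sub>R (J x *v u), l + t k *\<^sub>R \<eta>)"
      using elim k unfolding p(2)[symmetric]
      by (elim order_trans, intro mult_left_mono infdist_le) (auto simp: gph_def)
    also have "\<dots> = \<kappa> * (t k * norm (q k - J x *v u))"
    proof -
      have "g (x + t k *\<^sub>R u) - (g x + t k *\<^sub>R (J x *v u)) = t k *\<^sub>R (q k - J x *v u)"
        using t(1)[of k] by (simp add: q_def scaleR_diff_right)
      then show ?thesis using t(1)[of k] by (simp add: dist_Pair_Pair dist_norm)
    qed
    finally have le: "dist (x + t k *\<^sub>R u, l + t k *\<^sub>R \<eta>) (p k) \<le> \<kappa> * (t k * norm (q k - J x *v u))" .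
    have "(x + t k *\<^sub>R u, l + t k *\<^sub>R \<eta>) - p k = - (t k *\<^sub>R (w k - (u, \<eta>)))"
      by (simp add: pw prod_eq_iff scaleR_diff_right)
    then have "dist (x + t k *\<^sub>R u, l + t k *\<^sub>R \<eta>) (p k) = t k * norm (w k - (u, \<eta>))"
      using t(1)[of k] by (simp add: dist_norm)
    with le t(1)[of k] show ?case by (simp add: mult.left_commute[of \<kappa>])
  qed
  have "(\<lambda>k. \<kappa> * norm (q k - J x *v u)) \<longlonglongrightarrow> \<kappa> * norm (J x *v u - J x *v u)" by (intro tendsto_intros q)
  then have "(\<lambda>k. norm (w k - (u, \<eta>))) \<longlonglongrightarrow> 0"
    by (intro tendsto_sandwich[OF _ bound tendsto_const]) auto
  then have w: "w \<longlonglongrightarrow> (u, \<eta>)" by (simp add: tendsto_norm_zero_iff LIM_zero_iff)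
  have w1: "(\<lambda>k. fst (w k)) \<longlonglongrightarrow> u" and w2: "(\<lambda>k. snd (w k)) \<longlonglongrightarrow> \<eta>"
    using tendsto_fst[OF w] tendsto_snd[OF w] by simp_all
  define m where "m k = l + t k *\<^sub>R snd (w k)" for k
  have m: "m \<longlonglongrightarrow> l"
    using tendsto_add[OF tendsto_const tendsto_scaleR[OF t(2) w2], of l] by (simp add: m_def [abs_def])
  define us where "us k = (transpose (J (x + t k *\<^sub>R fst (w k))) *v m k - transpose (J x) *v m k) /\<^sub>R t k
      + transpose (J x) *v snd (w k)" for k
  have us: "us \<longlonglongrightarrow> H l x *v u + transpose (J x) *v \<eta>"
    unfolding us_def [abs_def]
    by (intro tendsto_add jacobian_transpose_quotient tendsto_jacobian_transpose tendsto_const w1 w2 m t(2))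
       (simp add: t(1))
  have "xs + t k *\<^sub>R us k = transpose (J (x + t k *\<^sub>R fst (w k))) *v m k" for k
    using t(1)[of k] lxs
    by (simp add: us_def m_def matrix_vector_right_distrib matrix_vector_mult_scaleR algebra_simps)
  moreover have "transpose (J (x + t k *\<^sub>R fst (w k))) *v m k \<in> limiting_normal_cone \<Gamma> (x + t k *\<^sub>R fst (w k))" for k
    using adjoint_normal p(1)[of k] by (simp add: pw m_def)
  ultimately have "(x, xs) + t k *\<^sub>R (fst (w k), us k) \<in> gph (limiting_normal_cone \<Gamma>)" for k
    by (simp add: gph_def)
  moreover have "(\<lambda>k. (fst (w k), us k)) \<longlonglongrightarrow> (u, H l x *v u + transpose (J x) *v \<eta>)"
    by (intro tendsto_intros w1 us)
  moreover have "(x, xs) \<in> gph (limiting_normal_cone \<Gamma>)"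
    using adjoint_normal[OF lN] lxs by (simp add: gph_def)
  ultimately show ?thesis
    unfolding graphical_derivative_def tangent_cone_def using t by blast
qed

section \<open>Nondegeneracy implies directional subregularity\<close>

text \<open>
  Let \<open>(y k, lk k)\<close> be a nearest point of the graph, at distance \<open>\<rho> k\<close>, which is \<open>o(t)\<close> as \<open>(u, \<eta>)\<close> is
  a direction along the graph. Solving \<open>P (g xh) = P (y k)\<close> costs a multiple of \<open>\<rho> k\<close> and leaves a
  defect \<open>g xh - y k\<close> orthogonal to \<open>?N\<close>. Such a defect of size \<open>o(t)\<close> keeps the point in \<open>D\<close>, and the
  normal \<open>lk k\<close>, an element of \<open>?N\<close>, does not see it. So \<open>(xh, lk k)\<close> satisfies the graph condition.
\<close>
lemma nondegenerate_imp_dir_subregular: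
  assumes l: "l \<in> \<Lambda> (x, xs)"
    and eta: "\<eta> \<in> limiting_normal_cone (critical_cone D (g x) l) (J x *v u)"
    and ND: "\<And>\<mu>. \<lbrakk>transpose (J x) *v \<mu> = 0;
      \<mu> \<in> span (limiting_normal_cone (tangent_cone D (g x)) (J x *v u))\<rbrakk> \<Longrightarrow> \<mu> = 0"
  shows "dir_metrically_subregular F (x, l) (0, 0) (u, \<eta>)"
proof -
  have lN: "l \<in> limiting_normal_cone D (g x)" using l by (auto simp: \<Lambda>_iff)
  have gx: "g x \<in> D" using lN by (simp add: normal_D)
  let ?N = "limiting_normal_cone (tangent_cone D (g x)) (J x *v u)"
  let ?G = "gph (limiting_normal_cone D)"
  obtain P where P: "linear P" "\<And>y. P y \<in> span ?N" "\<And>y s. s \<in> span ?N \<Longrightarrow> (y - P y) \<bullet> s = 0"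
    "\<And>y. norm (P y) \<le> norm y"
    using orthogonal_projection_exists[OF subspace_span] by metis
  obtain B where B: "linear B" "\<And>s. s \<in> span ?N \<Longrightarrow> P (J x *v B s) = s"
    using subspace_injective_right_inverse[OF subspace_span P(1-3)] ND by metis
  have strictP: "\<exists>\<delta>>0. \<forall>y\<in>ball x \<delta>. \<forall>z\<in>ball x \<delta>.
      norm (P (g y) - P (g z) - P (J x *v (y - z))) \<le> \<epsilon> * norm (y - z)" if "\<epsilon> > 0" for \<epsilon>
    using strict_derivative[OF that, of x] P(4)
    by (metis (no_types, lifting) linear_diff[OF P(1)] order_trans)
  obtain \<delta> c where \<delta>: "\<delta> > 0" and c: "c > 0" and solve:
    "\<And>x' q. \<lbrakk>x' \<in> ball x \<delta>; q \<in> span ?N; norm (P (g x') - q) < \<delta>\<rbrakk> \<Longrightarrow>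
       \<exists>y. P (g y) = q \<and> norm (y - x') \<le> c * norm (P (g x') - q)"
    using solvability_from_right_inverse[where h = "\<lambda>y. P (g y)" and A = "\<lambda>w. P (J x *v w)",
        OF strictP subspace_span P(2) B] by blast
  obtain K where K: "K > 0" "\<And>w. norm (J x *v w) \<le> K * norm w"
    using linear_bounded_pos[OF matrix_vector_mul_linear[of "J x"]] by blast
  obtain \<delta>1 where \<delta>1: "\<delta>1 > 0"
    "\<And>y z. \<lbrakk>y \<in> ball x \<delta>1; z \<in> ball x \<delta>1\<rbrakk> \<Longrightarrow> norm (g y - g z - J x *v (y - z)) \<le> 1 * norm (y - z)"
    using strict_derivative[of 1 x] by auto
  have lip: "norm (g y - g z) \<le> (K + 1) * norm (y - z)" if "y \<in> ball x \<delta>1" "z \<in> ball x \<delta>1" for y z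
    using \<delta>1(2)[OF that] K(2)[of "y - z"] norm_triangle_sub[of "g y - g z" "J x *v (y - z)"]
    by (simp add: algebra_simps)
  have "\<forall>\<^sub>F k in sequentially. subregularity_estimate F (0, 0) (c + 1) ((x, l) + t k *\<^sub>R v k)"
    if t: "\<forall>k::nat. t k > (0::real)" "t \<longlonglongrightarrow> 0" and v: "v \<longlonglongrightarrow> (u, \<eta>)" for t v
  proof -
    define uk where "uk k = fst (v k)" for k
    define ek where "ek k = snd (v k)" for k
    have uk: "uk \<longlonglongrightarrow> u" and ek: "ek \<longlonglongrightarrow> \<eta>"
      using tendsto_fst[OF v] tendsto_snd[OF v] by (simp_all add: uk_def [abs_def] ek_def [abs_def])
    define X where "X k = x + t k *\<^sub>R uk k" for k
    define m where "m k = l + t k *\<^sub>R ek k" for k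
    have X: "X \<longlonglongrightarrow> x"
      using tendsto_add[OF tendsto_const tendsto_scaleR[OF t(2) uk], of x] by (simp add: X_def [abs_def])
    have tr: "filterlim t (at_right 0) sequentially" by (rule filterlim_at_right_zero_seq) (use t in auto)
    define q where "q k = (g (X k) - g x) /\<^sub>R t k" for k
    have q: "q \<longlonglongrightarrow> J x *v u"
      unfolding q_def [abs_def] X_def by (rule map_quotient) (use t uk in auto)
    have "\<exists>p\<in>?G. infdist (g (X k), m k) ?G = dist (g (X k), m k) p" for k
      using infdist_attains_inf[OF closed_gph_limiting_normal_cone[OF convex_D closed_D] gph_normal_D_nonempty[OF gx]]
      by metis
    then obtain p where p: "\<And>k. p k \<in> ?G" "\<And>k. infdist (g (X k), m k) ?G = dist (g (X k), m k) (p k)" by metis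
    define y where "y k = fst (p k)" for k
    define lk where "lk k = snd (p k)" for k
    have lky: "lk k \<in> limiting_normal_cone D (y k)" for k using p(1)[of k] by (auto simp: gph_def y_def lk_def)
    have yD: "y k \<in> D" for k using lky by (simp add: normal_D)
    define \<rho> where "\<rho> k = dist (g (X k), m k) (p k)" for k
    have \<rho>0: "\<rho> k \<ge> 0" for k by (simp add: \<rho>_def)
    have \<rho>1: "norm (g (X k) - y k) \<le> \<rho> k" and \<rho>2: "norm (m k - lk k) \<le> \<rho> k" for k
      using dist_fst_le[of "(g (X k), m k)" "p k"] dist_snd_le[of "(g (X k), m k)" "p k"]
      by (simp_all add: \<rho>_def y_def lk_def dist_norm)
    have step: "\<forall>\<^sub>F k in sequentially. l + t k *\<^sub>R \<eta> \<in> limiting_normal_cone D (g x + t k *\<^sub>R (J x *v u))"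
      using eventually_compose_filterlim[OF normal_cone_graph_step[OF D gx lN eta] tr] .
    have upper: "\<forall>\<^sub>F k in sequentially. \<rho> k / t k \<le> norm (q k - J x *v u) + norm (ek k - \<eta>)"
      using step
    proof (rule eventually_mono)
      fix k assume "l + t k *\<^sub>R \<eta> \<in> limiting_normal_cone D (g x + t k *\<^sub>R (J x *v u))"
      then have "\<rho> k \<le> dist (g (X k), m k) (g x + t k *\<^sub>R (J x *v u), l + t k *\<^sub>R \<eta>)"
        unfolding \<rho>_def p(2)[symmetric] by (intro infdist_le) (simp add: gph_def)
      also have "\<dots> \<le> norm (g (X k) - (g x + t k *\<^sub>R (J x *v u))) + norm (m k - (l + t k *\<^sub>R \<eta>))"
        by (simp add: dist_norm norm_Pair_le)
      also have "g (X k) - (g x + t k *\<^sub>R (J x *v u)) = t k *\<^sub>R (q k - J x *v u)"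
        using t(1)[rule_format, of k] by (simp add: q_def scaleR_diff_right)
      also have "m k - (l + t k *\<^sub>R \<eta>) = t k *\<^sub>R (ek k - \<eta>)" by (simp add: m_def scaleR_diff_right)
      also have "norm (t k *\<^sub>R (q k - J x *v u)) + norm (t k *\<^sub>R (ek k - \<eta>)) =
          (norm (q k - J x *v u) + norm (ek k - \<eta>)) * t k"
        using t(1)[rule_format, of k] by (simp add: distrib_left mult.commute[of _ "t k"])
      finally show "\<rho> k / t k \<le> norm (q k - J x *v u) + norm (ek k - \<eta>)"
        using t(1)[rule_format, of k] by (simp add: divide_le_eq)
    qed
    have "(\<lambda>k. norm (q k - J x *v u) + norm (ek k - \<eta>)) \<longlonglongrightarrow> norm (J x *v u - J x *v u) + norm (\<eta> - \<eta>)"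
      by (intro tendsto_intros q ek)
    then have lim0: "(\<lambda>k. norm (q k - J x *v u) + norm (ek k - \<eta>)) \<longlonglongrightarrow> 0" by simp
    have lower: "\<forall>\<^sub>F k in sequentially. 0 \<le> \<rho> k / t k"
      using \<rho>0 t(1) by (intro always_eventually allI divide_nonneg_pos) auto
    have \<rho>t: "(\<lambda>k. \<rho> k / t k) \<longlonglongrightarrow> 0"
      by (rule tendsto_sandwich[OF lower upper tendsto_const lim0])
    have "(\<lambda>k. t k * (\<rho> k / t k)) \<longlonglongrightarrow> 0 * 0" by (intro tendsto_intros t \<rho>t)
    then have \<rho>: "\<rho> \<longlonglongrightarrow> 0" using t(1) by (simp add: less_imp_neq[THEN not_sym])
    define vk where "vk k = (y k - g x) /\<^sub>R t k" for k
    have vky: "g x + t k *\<^sub>R vk k = y k" for k using t(1)[rule_format, of k] by (simp add: vk_def)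
    have "norm (vk k - q k) \<le> \<rho> k / t k" for k
    proof -
      have "vk k - q k = - ((g (X k) - y k) /\<^sub>R t k)" by (simp add: vk_def q_def algebra_simps)
      then show ?thesis using \<rho>1[of k] t(1)[rule_format, of k]
        by (simp only: norm_minus_cancel norm_scaleR) (simp add: field_simps)
    qed
    then have "(\<lambda>k. vk k - q k) \<longlonglongrightarrow> 0"
      by (intro Lim_null_comparison[OF _ \<rho>t] always_eventually) auto
    from tendsto_add[OF this q] have vk: "vk \<longlonglongrightarrow> J x *v u" by simp
    define good where "good k \<longleftrightarrow> X k \<in> ball x (min \<delta> (\<delta>1 / 2)) \<and> \<rho> k < \<delta> \<and> c * \<rho> k < \<delta>1 / 2" for k
    have "\<forall>\<^sub>F k in sequentially. X k \<in> ball x (min \<delta> (\<delta>1 / 2))"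
      using tendstoD[OF X, of "min \<delta> (\<delta>1 / 2)"] \<delta> \<delta>1 by (simp add: dist_commute)
    moreover have "\<forall>\<^sub>F k in sequentially. \<rho> k < \<delta>" using order_tendstoD(2)[OF \<rho> \<delta>] .
    moreover have "\<forall>\<^sub>F k in sequentially. c * \<rho> k < \<delta>1 / 2"
      using order_tendstoD(2)[OF tendsto_mult[OF tendsto_const \<rho>], of c "\<delta>1 / 2"] \<delta>1 by simp
    ultimately have ev_good: "\<forall>\<^sub>F k in sequentially. good k"
      by eventually_elim (simp add: good_def)
    have "\<exists>xh. P (g xh) = P (y k) \<and> norm (xh - X k) \<le> c * \<rho> k" if "good k" for k
    proof -
      have le: "norm (P (g (X k)) - P (y k)) \<le> \<rho> k"
        using P(4)[of "g (X k) - y k"] \<rho>1[of k] by (simp add: linear_diff[OF P(1)])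
      then obtain xh where "P (g xh) = P (y k)" "norm (xh - X k) \<le> c * norm (P (g (X k)) - P (y k))"
        using solve[of "X k" "P (y k)"] P(2) \<open>good k\<close> by (auto simp: good_def)
      moreover have "c * norm (P (g (X k)) - P (y k)) \<le> c * \<rho> k" using le c by simp
      ultimately show ?thesis by fastforce
    qed
    then obtain xh where xh: "\<And>k. good k \<Longrightarrow> P (g (xh k)) = P (y k)"
      "\<And>k. good k \<Longrightarrow> norm (xh k - X k) \<le> c * \<rho> k" by metis
    \<comment> \<open>The solution \<open>xh k\<close> exists only for large \<open>k\<close>; the value 0 elsewhere keeps the bound on \<open>w\<close>
        valid for all \<open>k\<close>.\<close>
    define w where "w k = (if good k then (g (xh k) - y k) /\<^sub>R t k else 0)" for k
    have w_le: "norm (w k) \<le> ((K + 1) * c + 1) * (\<rho> k / t k)" for k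
    proof (cases "good k")
      case True
      have "dist x (X k) < \<delta>1 / 2" using True by (simp add: good_def)
      moreover have "dist (X k) (xh k) < \<delta>1 / 2" using True xh(2)[OF True] by (simp add: good_def dist_norm norm_minus_commute)
      ultimately have "X k \<in> ball x \<delta>1" "xh k \<in> ball x \<delta>1"
        using dist_triangle[of x "xh k" "X k"] \<delta>1(1) by auto
      then have "norm (g (xh k) - g (X k)) \<le> (K + 1) * norm (xh k - X k)" by (intro lip)
      also have "\<dots> \<le> (K + 1) * (c * \<rho> k)"
        using xh(2)[OF True] K(1) by (intro mult_left_mono) auto
      finally have "norm (g (xh k) - y k) \<le> (K + 1) * (c * \<rho> k) + \<rho> k"
        using \<rho>1[of k] norm_triangle_ineq[of "g (xh k) - g (X k)" "g (X k) - y k"] by simp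
      then have "norm (g (xh k) - y k) / t k \<le> ((K + 1) * (c * \<rho> k) + \<rho> k) / t k"
        using t(1)[rule_format, of k] by (intro divide_right_mono) auto
      moreover have "norm (w k) = norm (g (xh k) - y k) / t k"
        using True t(1)[rule_format, of k] by (simp only: w_def if_True norm_scaleR) (simp add: divide_inverse)
      ultimately show ?thesis by (simp add: algebra_simps add_divide_distrib)
    next
      case False
      have "0 \<le> ((K + 1) * c + 1) * (\<rho> k / t k)"
        using K(1) c \<rho>0[of k] t(1)[rule_format, of k] by simp
      then show ?thesis using False by (simp add: w_def)
    qed
    have "(\<lambda>k. ((K + 1) * c + 1) * (\<rho> k / t k)) \<longlonglongrightarrow> ((K + 1) * c + 1) * 0"
      by (intro tendsto_intros \<rho>t)
    then have "(\<lambda>k. ((K + 1) * c + 1) * (\<rho> k / t k)) \<longlonglongrightarrow> 0" by simp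
    with always_eventually[OF allI[OF w_le]] have w: "w \<longlonglongrightarrow> 0"
      by (rule Lim_null_comparison)
    have orth: "n \<bullet> w k = 0" if "n \<in> ?N" for n k
    proof (cases "good k")
      case True
      have n: "n \<in> span ?N" using that by (rule span_base)
      have "(g (xh k) - y k) \<bullet> n = (g (xh k) - P (g (xh k))) \<bullet> n - (y k - P (y k)) \<bullet> n"
        using xh(1)[OF True] by (simp add: inner_diff_left)
      also have "\<dots> = 0" using P(3)[OF n] by simp
      finally show ?thesis using True by (simp add: w_def inner_commute)
    qed (simp add: w_def)
    have "\<forall>\<^sub>F k in sequentially. g x + t k *\<^sub>R (vk k + w k) \<in> D"
      using polyhedron_feasible_perturbation[OF D gx _ t(2) vk _ w orth] t(1) vky yD by simp
    moreover have "\<forall>\<^sub>F k in sequentially. limiting_normal_cone D (y k) \<subseteq> ?N"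
      using normal_cone_near_direction[OF D gx _ t(2) vk] t(1) vky yD by simp
    ultimately show ?thesis using ev_good
    proof eventually_elim
      case (elim k)
      have gxh: "g (xh k) = y k + t k *\<^sub>R w k"
        using elim t(1)[rule_format, of k] by (simp add: w_def)
      have inD: "g (xh k) \<in> D" using elim(1) vky[of k] gxh by (simp add: scaleR_add_right add.assoc[symmetric])
      have "lk k \<bullet> w k = 0" using elim(2) lky[of k] orth by blast
      then have "lk k \<in> limiting_normal_cone D (g (xh k))"
        using inD lky[of k] by (simp add: normal_D gxh inner_simps)
      then have "infdist (X k, m k) {(x, l). l \<in> limiting_normal_cone D (g x)} \<le> dist (X k, m k) (xh k, lk k)"
        by (intro infdist_le) simp
      also have "\<dots> \<le> norm (X k - xh k) + norm (m k - lk k)"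
        by (simp add: dist_norm norm_Pair_le)
      also have "\<dots> \<le> (c + 1) * \<rho> k"
        using xh(2)[OF elim(3)] \<rho>2[of k] by (simp add: norm_minus_commute algebra_simps)
      finally have "subregularity_estimate F (0, 0) (c + 1) (X k, m k)"
        by (simp add: subregularity_estimate_F[OF gx] p(2) \<rho>_def)
      moreover have "(x, l) + t k *\<^sub>R v k = (X k, m k)" by (simp add: X_def m_def uk_def ek_def prod_eq_iff)
      ultimately show ?case by simp
    qed
  qed
  moreover have "((x, l), (0, 0)) \<in> gph F" using lN by (simp add: gph_def F)
  ultimately show ?thesis using c unfolding dir_metrically_subregular_def by (intro conjI exI[of _ "c + 1"]) auto
qed

section \<open>The directional limiting coderivative\<close>

text \<open>
  Testing the regular normal on the tangents with \<open>\<eta> = 0\<close> shows that \<open>zs - H l x *v ws\<close> is polar to the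
  preimage of the critical cone, hence of the form \<open>transpose (J x) *v \<zeta>\<close>; testing on \<open>u = 0\<close> places
  \<open>- (J x *v ws)\<close> in the bipolar of the critical cone. The symmetry of the Hessian moves it
  from \<open>u\<close> to \<open>ws\<close>.
\<close>
lemma regular_normal_graph:
  assumes l: "l \<in> \<Lambda> (x, xs)"
    and inj: "\<And>\<mu>. \<lbrakk>transpose (J x) *v \<mu> = 0; \<mu> \<in> span (limiting_normal_cone D (g x))\<rbrakk> \<Longrightarrow> \<mu> = 0"
    and reg: "(zs, - ws) \<in> regular_normal_cone (gph (limiting_normal_cone \<Gamma>)) (x, xs)"
  shows "\<exists>\<zeta>\<in>span (limiting_normal_cone D (g x)). zs = H l x *v ws + transpose (J x) *v \<zeta> \<and>
     (\<zeta>, - (J x *v ws)) \<in> regular_normal_cone (gph (limiting_normal_cone D)) (g x, l)"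
proof -
  have lN: "l \<in> limiting_normal_cone D (g x)" using l by (auto simp: \<Lambda>_iff)
  have gx: "g x \<in> D" using lN by (simp add: normal_D)
  let ?K = "critical_cone D (g x) l"
  have main: "(zs - H l x *v ws) \<bullet> u - (J x *v ws) \<bullet> \<eta> \<le> 0"
    if eta: "\<eta> \<in> limiting_normal_cone ?K (J x *v u)" for u \<eta>
  proof -
    have "limiting_normal_cone (tangent_cone D (g x)) (J x *v u) \<subseteq> limiting_normal_cone D (g x)"
      using limiting_normal_cone_tangent[OF D gx] by blast
    then have "dir_metrically_subregular F (x, l) (0, 0) (u, \<eta>)"
      using inj span_mono by (intro nondegenerate_imp_dir_subregular[OF l eta]) blast
    from graphical_derivative_superset[OF l eta this]
    have "(u, H l x *v u + transpose (J x) *v \<eta>) \<in> tangent_cone (gph (limiting_normal_cone \<Gamma>)) (x, xs)"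
      by (simp add: graphical_derivative_def)
    then have "(zs, - ws) \<bullet> (u, H l x *v u + transpose (J x) *v \<eta>) \<le> 0"
      using reg unfolding regular_normal_cone_def negative_polar_def by (auto split: if_splits)
    moreover have "ws \<bullet> (transpose (J x) *v \<eta>) = (J x *v ws) \<bullet> \<eta>"
      by (metis inner_commute inner_transpose_matrix)
    moreover have "ws \<bullet> (H l x *v u) = (H l x *v ws) \<bullet> u"
      using hessian_symmetric[of l x ws u] by simp
    ultimately show ?thesis by (simp add: inner_simps)
  qed
  have K: "polyhedron ?K" using polyhedron_critical_cone[OF D gx] .
  have zeroN: "0 \<in> limiting_normal_cone ?K v" if "v \<in> ?K" for v
    using that by (simp add: limiting_normal_cone_critical[OF D gx])
  have z0: "0 \<in> ?K" using conic_critical_cone[OF D gx, of l] tangent_coneI_feasible[OF convex_D gx gx]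
    by (simp add: critical_cone_def)
  have "zs - H l x *v ws \<in> limiting_normal_cone {u. J x *v u \<in> ?K} 0"
  proof (subst limiting_normal_cone_convex)
    show "convex {u. J x *v u \<in> ?K}"
      using convex_linear_vimage[OF matrix_vector_mul_linear polyhedron_imp_convex[OF K], of "J x"]
      by (simp add: vimage_def)
    show "0 \<in> {u. J x *v u \<in> ?K} \<and> (\<forall>p\<in>{u. J x *v u \<in> ?K}. (zs - H l x *v ws) \<bullet> (p - 0) \<le> 0)"
      using main[OF zeroN] z0 by simp
  qed
  then obtain \<zeta> where \<zeta>: "zs - H l x *v ws = transpose (J x) *v \<zeta>" "\<zeta> \<in> limiting_normal_cone ?K 0"
    unfolding limiting_normal_cone_linear_preimage[OF K] by auto
  have \<zeta>K: "\<zeta> \<bullet> w \<le> 0" if "w \<in> ?K" for w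
    using \<zeta>(2) that by (simp add: limiting_normal_cone_critical[OF D gx])
  have wsK: "- (J x *v ws) \<in> ?K"
  proof (rule critical_cone_bipolar[OF D gx lN])
    fix \<eta> assume "\<forall>w\<in>?K. \<eta> \<bullet> w \<le> 0"
    then have "\<eta> \<in> limiting_normal_cone ?K (J x *v 0)" using z0 by (simp add: limiting_normal_cone_critical[OF D gx])
    from main[OF this] show "\<eta> \<bullet> (- (J x *v ws)) \<le> 0" by (simp add: inner_commute)
  qed
  have "(\<zeta>, - (J x *v ws)) \<bullet> d \<le> 0" if "d \<in> tangent_cone (gph (limiting_normal_cone D)) (g x, l)" for d
  proof -
    obtain v \<eta> where d: "d = (v, \<eta>)" by (cases d)
    have "v \<in> ?K" "\<forall>w\<in>?K. \<eta> \<bullet> w \<le> 0" using tangent_graph_normal_cone[OF D gx] that d by auto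
    then have "\<zeta> \<bullet> v \<le> 0" "\<eta> \<bullet> (- (J x *v ws)) \<le> 0" using \<zeta>K wsK by blast+
    then show ?thesis by (simp add: d inner_commute)
  qed
  then have "(\<zeta>, - (J x *v ws)) \<in> regular_normal_cone (gph (limiting_normal_cone D)) (g x, l)"
    using lN by (simp add: regular_normal_cone_def negative_polar_def gph_def)
  moreover have "\<zeta> \<in> span (limiting_normal_cone D (g x))"
    using critical_cone_polar_subset_span[OF D gx lN] \<zeta>K by blast
  ultimately show ?thesis using \<zeta>(1) by (intro bexI[of _ \<zeta>]) (simp_all add: algebra_simps)
qed

text \<open>
  Regular normals at points near \<open>x\<close> have the asserted form. The vectors \<open>z k\<close> and the quotients
  \<open>e k\<close> lie in the span of \<open>?N\<close>, on which the transposed Jacobians near \<open>x\<close> are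
  uniformly injective. So both stay bounded, and a common subsequence delivers \<open>\<zeta>\<close> and \<open>\<eta>\<close>.
\<close>
lemma dir_limiting_coderivative_subset:
  assumes eb: "\<forall>\<^sub>F y in nhds x. error_bound \<kappa> y"
    and ND: "\<And>\<mu>. \<lbrakk>transpose (J x) *v \<mu> = 0;
      \<mu> \<in> span (limiting_normal_cone (tangent_cone D (g x)) (J x *v u))\<rbrakk> \<Longrightarrow> \<mu> = 0"
    and zs: "zs \<in> dir_limiting_coderivative (limiting_normal_cone \<Gamma>) (x, xs) (u, us) ws"
  shows "\<exists>l\<in>\<Lambda> (x, xs). \<exists>\<eta>\<in>graphical_derivative \<Lambda> ((x, xs), l) (u, us).
    \<exists>\<zeta>\<in>dir_limiting_coderivative (limiting_normal_cone D) (g x, l) (J x *v u, \<eta>) (J x *v ws).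
      zs = H l x *v ws + transpose (J x) *v \<zeta>"
proof -
  let ?N = "limiting_normal_cone (tangent_cone D (g x)) (J x *v u)"
  from zs obtain t p ys where t: "\<And>k::nat. t k > (0::real)" "t \<longlonglongrightarrow> 0"
    and p: "p \<longlonglongrightarrow> (u, us)" and ys: "ys \<longlonglongrightarrow> (zs, - ws)"
    and reg: "\<And>k. ys k \<in> regular_normal_cone (gph (limiting_normal_cone \<Gamma>)) ((x, xs) + t k *\<^sub>R p k)"
    unfolding dir_limiting_coderivative_def dir_limiting_normal_cone_def by blast
  define uk where "uk k = fst (p k)" for k
  define usk where "usk k = snd (p k)" for k
  have uk: "uk \<longlonglongrightarrow> u" and usk: "usk \<longlonglongrightarrow> us"
    using tendsto_fst[OF p] tendsto_snd[OF p] by (simp_all add: uk_def [abs_def] usk_def [abs_def])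
  define zk where "zk k = fst (ys k)" for k
  define wk where "wk k = - snd (ys k)" for k
  have zk: "zk \<longlonglongrightarrow> zs" and wk: "wk \<longlonglongrightarrow> ws"
    using tendsto_fst[OF ys] tendsto_minus[OF tendsto_snd[OF ys]] by (simp_all add: zk_def [abs_def] wk_def [abs_def])
  have pk: "(x, xs) + t k *\<^sub>R p k = (x + t k *\<^sub>R uk k, xs + t k *\<^sub>R usk k)" for k
    by (simp add: uk_def usk_def prod_eq_iff)
  have reg': "(zk k, - wk k) \<in> regular_normal_cone (gph (limiting_normal_cone \<Gamma>)) (x + t k *\<^sub>R uk k, xs + t k *\<^sub>R usk k)" for k
    using reg[of k] by (simp add: pk zk_def wk_def)
  have mem: "xs + t k *\<^sub>R usk k \<in> limiting_normal_cone \<Gamma> (x + t k *\<^sub>R uk k)" for k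
    using reg'[of k] by (auto simp: regular_normal_cone_def gph_def split: if_splits)
  obtain r :: "nat \<Rightarrow> nat" and l l0 where r: "strict_mono r" and l: "l \<longlonglongrightarrow> l0" and l0: "l0 \<in> \<Lambda> (x, xs)"
    and lk: "\<And>k. l k \<in> \<Lambda> (x + t (r k) *\<^sub>R uk (r k), xs + t (r k) *\<^sub>R usk (r k))"
    and l0N: "l0 \<in> ?N"
    and near: "\<And>k. limiting_normal_cone D (g (x + t (r k) *\<^sub>R uk (r k))) \<subseteq> ?N"
    and conv: "(\<lambda>k. transpose (J x) *v ((l k - l0) /\<^sub>R t (r k))) \<longlonglongrightarrow> us - H l0 x *v u"
    by (rule multiplier_subsequence[OF eb t uk usk mem], rule that)
  have sub: "(\<lambda>k. f (r k)) \<longlonglongrightarrow> a" if "f \<longlonglongrightarrow> a" for f :: "nat \<Rightarrow> 'b::metric_space" and a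
    using LIMSEQ_subseq_LIMSEQ[OF that r] by (simp add: o_def)
  define X where "X k = x + t (r k) *\<^sub>R uk (r k)" for k
  have X: "X \<longlonglongrightarrow> x"
    using tendsto_add[OF tendsto_const tendsto_scaleR[OF sub[OF t(2)] sub[OF uk]], of x] by (simp add: X_def [abs_def])
  define e where "e k = (l k - l0) /\<^sub>R t (r k)" for k
  have eS: "e k \<in> span ?N" for k
    using near[of k] lk[of k] l0N unfolding e_def
    by (intro span_scale span_diff span_base) (auto simp: \<Lambda>_iff)
  obtain c where c: "c > 0" "\<And>s. s \<in> span ?N \<Longrightarrow> c * norm s \<le> norm (transpose (J x) *v s)"
    using injective_imp_isometric[OF closed_subspace[OF subspace_span] subspace_span
        linear_conv_bounded_linear[THEN iffD1, OF matrix_vector_mul_linear], of ?N "transpose (J x)"] ND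
    by (metis mult.commute)
  have pert: "\<forall>\<^sub>F k in sequentially. \<forall>\<zeta>. norm (transpose (J (X k)) *v \<zeta> - transpose (J x) *v \<zeta>) \<le> (c / 2) * norm \<zeta>"
    using jacobian_transpose_perturbation[OF X, of "c / 2"] c(1) by simp
  then obtain N where N: "\<And>k \<zeta>. k \<ge> N \<Longrightarrow> norm (transpose (J (X k)) *v \<zeta> - transpose (J x) *v \<zeta>) \<le> (c / 2) * norm \<zeta>"
    by (auto simp: eventually_sequentially)
  have low: "(c / 2) * norm s \<le> norm (transpose (J (X k)) *v s)" if "s \<in> span ?N" "k \<ge> N" for s k
    using c(2)[OF that(1)] N[OF that(2), of s]
      norm_triangle_sub[of "transpose (J x) *v s" "transpose (J (X k)) *v s"]
    by (simp add: norm_minus_commute)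
  have "\<exists>\<zeta>\<in>span ?N. zk (r k) = H (l k) (X k) *v wk (r k) + transpose (J (X k)) *v \<zeta> \<and>
     (\<zeta>, - (J (X k) *v wk (r k))) \<in> regular_normal_cone (gph (limiting_normal_cone D)) (g (X k), l k)"
    if k: "k \<ge> N" for k
  proof -
    have sp: "span (limiting_normal_cone D (g (X k))) \<subseteq> span ?N"
      using near[of k] by (intro span_mono) (simp add: X_def)
    have "\<mu> = 0" if "transpose (J (X k)) *v \<mu> = 0" "\<mu> \<in> span (limiting_normal_cone D (g (X k)))" for \<mu>
    proof -
      have "(c / 2) * norm \<mu> \<le> 0" using low[of \<mu> k] sp that k by auto
      then show ?thesis using c(1) by (simp add: mult_le_0_iff)
    qed
    from regular_normal_graph[OF lk[of k, folded X_def] this reg'[of "r k", folded X_def]]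
    show ?thesis using sp by blast
  qed
  then obtain z where z: "\<And>k. k \<ge> N \<Longrightarrow> z k \<in> span ?N"
    "\<And>k. k \<ge> N \<Longrightarrow> zk (r k) = H (l k) (X k) *v wk (r k) + transpose (J (X k)) *v z k"
    "\<And>k. k \<ge> N \<Longrightarrow> (z k, - (J (X k) *v wk (r k))) \<in> regular_normal_cone (gph (limiting_normal_cone D)) (g (X k), l k)"
    by metis
  have lim_q: "(\<lambda>k. zk (r k) - H (l k) (X k) *v wk (r k)) \<longlonglongrightarrow> zs - H l0 x *v ws"
    by (intro tendsto_diff sub[OF zk] tendsto_hessian X l sub[OF wk])
  obtain M1 where M1: "\<And>k. norm (zk (r k) - H (l k) (X k) *v wk (r k)) \<le> M1"
    using convergent_imp_bounded[OF lim_q] by (auto simp: bounded_iff)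
  obtain M2 where M2: "\<And>k. norm (transpose (J x) *v e k) \<le> M2"
    using convergent_imp_bounded[OF conv] by (auto simp: bounded_iff e_def)
  have "norm (z (k + N)) \<le> M1 / (c / 2)" for k
  proof -
    have "(c / 2) * norm (z (k + N)) \<le> norm (transpose (J (X (k + N))) *v z (k + N))"
      by (rule low) (use z in auto)
    also have "\<dots> \<le> M1" using M1[of "k + N"] z(2)[of "k + N"] by simp
    finally show ?thesis using c(1) by (simp add: field_simps)
  qed
  moreover have "norm (e (k + N)) \<le> M2 / c" for k
    using c(2)[OF eS[of "k + N"]] M2[of "k + N"] c(1) by (simp add: field_simps)
  ultimately have "bounded (range (\<lambda>k. z (k + N)))" "bounded (range (\<lambda>k. e (k + N)))"
    unfolding bounded_iff by blast+
  then have "bounded (range (\<lambda>k. (z (k + N), e (k + N))))"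
    by (elim bounded_subset[OF bounded_Times]) auto
  then obtain r' q0 where r': "strict_mono (r' :: nat \<Rightarrow> nat)" "(\<lambda>k. (z (r' k + N), e (r' k + N))) \<longlonglongrightarrow> q0"
    by (rule convergent_subsequence_of_bounded)
  define \<zeta> where "\<zeta> = fst q0"
  define \<eta> where "\<eta> = snd q0"
  define s where "s k = r' k + N" for k
  have sm: "strict_mono s" using r'(1) by (simp add: s_def strict_mono_def)
  have sN: "s k \<ge> N" for k by (simp add: s_def)
  have zl: "(\<lambda>k. z (s k)) \<longlonglongrightarrow> \<zeta>" and el: "(\<lambda>k. e (s k)) \<longlonglongrightarrow> \<eta>"
    using tendsto_fst[OF r'(2)] tendsto_snd[OF r'(2)] by (simp_all add: s_def \<zeta>_def \<eta>_def)
  have sub': "(\<lambda>k. f (s k)) \<longlonglongrightarrow> a" if "f \<longlonglongrightarrow> a" for f :: "nat \<Rightarrow> 'b::metric_space" and a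
    using LIMSEQ_subseq_LIMSEQ[OF that sm] by (simp add: o_def)
  have T: "t (r (s k)) > 0" "(\<lambda>k. t (r (s k))) \<longlonglongrightarrow> 0" for k
    using t sub'[OF sub[OF t(2)]] by auto
  have le: "l0 + t (r k) *\<^sub>R e k = l k" for k using t(1)[of "r k"] by (simp add: e_def)
  have eta: "\<eta> \<in> graphical_derivative \<Lambda> ((x, xs), l0) (u, us)"
    unfolding graphical_derivative_def tangent_cone_def
  proof (intro CollectI conjI exI allI)
    show "((x, xs), l0) \<in> gph \<Lambda>" using l0 by (simp add: gph_def)
    show "(\<lambda>k. ((uk (r (s k)), usk (r (s k))), e (s k))) \<longlonglongrightarrow> ((u, us), \<eta>)"
      by (intro tendsto_Pair sub'[OF sub[OF uk]] sub'[OF sub[OF usk]] el)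
    show "((x, xs), l0) + t (r (s k)) *\<^sub>R ((uk (r (s k)), usk (r (s k))), e (s k)) \<in> gph \<Lambda>" for k
      using lk[of "s k"] by (simp add: gph_def le)
  qed (use T in auto)
  define v where "v k = (g (X k) - g x) /\<^sub>R t (r k)" for k
  have v: "v \<longlonglongrightarrow> J x *v u" unfolding v_def [abs_def] X_def
    by (rule map_quotient) (use t sub[OF t(2)] sub[OF uk] in auto)
  have vX: "g x + t (r k) *\<^sub>R v k = g (X k)" for k using t(1)[of "r k"] by (simp add: v_def)
  have "(\<zeta>, - (J x *v ws)) \<in> dir_limiting_normal_cone (gph (limiting_normal_cone D)) (g x, l0) (J x *v u, \<eta>)"
    unfolding dir_limiting_normal_cone_def
  proof (intro CollectI conjI exI allI)
    show "(g x, l0) \<in> gph (limiting_normal_cone D)" using l0 by (simp add: gph_def \<Lambda>_iff)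
    show "(\<lambda>k. (v (s k), e (s k))) \<longlonglongrightarrow> (J x *v u, \<eta>)" by (intro tendsto_Pair sub'[OF v] el)
    show "(\<lambda>k. (z (s k), - (J (X (s k)) *v wk (r (s k))))) \<longlonglongrightarrow> (\<zeta>, - (J x *v ws))"
      by (intro tendsto_Pair zl tendsto_minus tendsto_jacobian sub'[OF X] sub'[OF sub[OF wk]])
    show "(z (s k), - (J (X (s k)) *v wk (r (s k)))) \<in>
      regular_normal_cone (gph (limiting_normal_cone D)) ((g x, l0) + t (r (s k)) *\<^sub>R (v (s k), e (s k)))" for k
      using z(3)[OF sN[of k]] by (simp add: vX le)
  qed (use T in auto)
  then have "\<zeta> \<in> dir_limiting_coderivative (limiting_normal_cone D) (g x, l0) (J x *v u, \<eta>) (J x *v ws)"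
    by (simp add: dir_limiting_coderivative_def)
  moreover have "zs = H l0 x *v ws + transpose (J x) *v \<zeta>"
  proof (rule LIMSEQ_unique)
    show "(\<lambda>k. zk (r (s k))) \<longlonglongrightarrow> zs" using sub'[OF sub[OF zk]] .
    have "(\<lambda>k. H (l (s k)) (X (s k)) *v wk (r (s k)) + transpose (J (X (s k))) *v z (s k))
        \<longlonglongrightarrow> H l0 x *v ws + transpose (J x) *v \<zeta>"
      by (intro tendsto_add tendsto_hessian tendsto_jacobian_transpose sub'[OF X] sub'[OF l] sub'[OF sub[OF wk]] zl)
    then show "(\<lambda>k. zk (r (s k))) \<longlonglongrightarrow> H l0 x *v ws + transpose (J x) *v \<zeta>"
      using z(2)[OF sN] by simp
  qed
  ultimately show ?thesis using l0 eta by blast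
qed

end

section \<open>First- and second-order formulas for the normal cone map\<close>

theorem theorem5p2:
  fixes D :: "(real ^ 's) set"
    and g :: "real ^ 'n \<Rightarrow> real ^ 's"
    and \<Gamma> :: "(real ^ 'n) set"
    and xbar :: "real ^ 'n"
    and F :: "(real ^ 'n) \<times> (real ^ 's) \<Rightarrow> ((real ^ 's) \<times> (real ^ 's)) set"
    and \<Lambda> :: "(real ^ 'n) \<times> (real ^ 'n) \<Rightarrow> (real ^ 's) set"
    and J :: "real ^ 'n \<Rightarrow> real ^ 'n ^ 's"
    and H :: "real ^ 's \<Rightarrow> real ^ 'n \<Rightarrow> real ^ 'n ^ 'n"
  assumes D: "polyhedron D"
    and g: "twice_continuously_differentiable g"
    and \<Gamma>: "\<Gamma> = {x. g x \<in> D}"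
    and xbar: "xbar \<in> \<Gamma>"
    and subreg: "metrically_subregular (\<lambda>x. {g x - d | d. d \<in> D}) xbar 0"
    and J: "J = (\<lambda>x. jacobian g (at x))"
    and H: "H = (\<lambda>l. hessian (\<lambda>x. l \<bullet> g x))"
    and F: "F = (\<lambda>(x, l). {(g x, l) - p | p. p \<in> gph (limiting_normal_cone D)})"
    and \<Lambda>: "\<Lambda> = (\<lambda>(x, xs). {l \<in> limiting_normal_cone D (g x). transpose (J x) *v l = xs})"
  shows "\<forall>\<^sub>F x in nhds xbar. \<forall>xs \<in> limiting_normal_cone \<Gamma> x. \<forall>u.
    (let DN = graphical_derivative (limiting_normal_cone \<Gamma>) (x, xs) u;
         R = (\<Union>l \<in> \<Lambda> (x, xs). {H l x *v u + transpose (J x) *v \<mu> | \<mu>.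
                \<mu> \<in> limiting_normal_cone (critical_cone D (g x) l) (J x *v u)});
         SR = (\<forall>l \<in> \<Lambda> (x, xs). \<forall>\<eta> \<in> limiting_normal_cone (critical_cone D (g x) l) (J x *v u).
                dir_metrically_subregular F (x, l) (0, 0) (u, \<eta>));
         ND = (\<forall>\<mu>. transpose (J x) *v \<mu> = 0 \<longrightarrow>
                \<mu> \<in> span (limiting_normal_cone (tangent_cone D (g x)) (J x *v u)) \<longrightarrow> \<mu> = 0)
     in DN \<subseteq> R
        \<and> R = (\<Union>l \<in> \<Lambda> (x, xs). {H l x *v u + \<nu> | \<nu>.
                \<nu> \<in> limiting_normal_cone (critical_cone \<Gamma> x xs) u})
        \<and> (SR \<longrightarrow> R \<subseteq> DN)
        \<and> (ND \<longrightarrow> SR \<and> R \<subseteq> DN)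
        \<and> (ND \<longrightarrow> (\<forall>ws. \<forall>us \<in> DN.
             dir_limiting_coderivative (limiting_normal_cone \<Gamma>) (x, xs) (u, us) ws
             \<subseteq> (\<Union>l \<in> \<Lambda> (x, xs). \<Union>\<eta> \<in> graphical_derivative \<Lambda> ((x, xs), l) (u, us).
                  {H l x *v ws + transpose (J x) *v \<zeta> | \<zeta>.
                   \<zeta> \<in> dir_limiting_coderivative (limiting_normal_cone D)
                         (g x, l) (J x *v u, \<eta>) (J x *v ws)}))))"
proof -
  interpret polyhedral_constraint g J H D \<Gamma> \<Lambda> F
    by unfold_locales (fact g J H D \<Gamma> \<Lambda> F)+
  obtain \<kappa> where "\<forall>\<^sub>F x in nhds xbar. error_bound \<kappa> x"
    using metrically_subregular_imp_error_bound[OF subreg] .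
  then have "\<forall>\<^sub>F x in nhds xbar. \<forall>\<^sub>F y in nhds x. error_bound \<kappa> y"
    by (simp add: eventually_eventually)
  then show ?thesis
  proof (rule eventually_mono, intro ballI allI)
    fix x xs u
    assume eb: "\<forall>\<^sub>F y in nhds x. error_bound \<kappa> y" and xs: "xs \<in> limiting_normal_cone \<Gamma> x"
    have x: "x \<in> \<Gamma>" using xs by (simp add: limiting_normal_cone_def)
    have ebx: "error_bound \<kappa> x" using eventually_nhds_x_imp_x[OF eb] .
    define DN where "DN = graphical_derivative (limiting_normal_cone \<Gamma>) (x, xs) u"
    define R where "R = (\<Union>l \<in> \<Lambda> (x, xs). {H l x *v u + transpose (J x) *v \<mu> | \<mu>.
                \<mu> \<in> limiting_normal_cone (critical_cone D (g x) l) (J x *v u)})"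
    define SR where "SR \<longleftrightarrow> (\<forall>l \<in> \<Lambda> (x, xs). \<forall>\<eta> \<in> limiting_normal_cone (critical_cone D (g x) l) (J x *v u).
                dir_metrically_subregular F (x, l) (0, 0) (u, \<eta>))"
    define ND where "ND \<longleftrightarrow> (\<forall>\<mu>. transpose (J x) *v \<mu> = 0 \<longrightarrow>
                \<mu> \<in> span (limiting_normal_cone (tangent_cone D (g x)) (J x *v u)) \<longrightarrow> \<mu> = 0)"
    have 1: "DN \<subseteq> R"
      using graphical_derivative_subset[OF eb] unfolding DN_def R_def by blast
    have 2: "R = (\<Union>l \<in> \<Lambda> (x, xs). {H l x *v u + \<nu> | \<nu>. \<nu> \<in> limiting_normal_cone (critical_cone \<Gamma> x xs) u})"
      unfolding R_def
    proof (rule SUP_cong[OF refl])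
      fix l assume "l \<in> \<Lambda> (x, xs)"
      then have eq: "limiting_normal_cone (critical_cone \<Gamma> x xs) u =
          (*v) (transpose (J x)) ` limiting_normal_cone (critical_cone D (g x) l) (J x *v u)"
        by (rule normal_cone_critical_cone_\<Gamma>[OF x ebx])
      show "{H l x *v u + transpose (J x) *v \<mu> | \<mu>. \<mu> \<in> limiting_normal_cone (critical_cone D (g x) l) (J x *v u)}
         = {H l x *v u + \<nu> | \<nu>. \<nu> \<in> limiting_normal_cone (critical_cone \<Gamma> x xs) u}"
        unfolding eq by blast
    qed
    have 3: "R \<subseteq> DN" if SR
      using graphical_derivative_superset that unfolding R_def DN_def SR_def by blast
    have 4: SR if ND
      using nondegenerate_imp_dir_subregular that unfolding SR_def ND_def by blast
    have 5: "dir_limiting_coderivative (limiting_normal_cone \<Gamma>) (x, xs) (u, us) ws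
             \<subseteq> (\<Union>l \<in> \<Lambda> (x, xs). \<Union>\<eta> \<in> graphical_derivative \<Lambda> ((x, xs), l) (u, us).
                  {H l x *v ws + transpose (J x) *v \<zeta> | \<zeta>.
                   \<zeta> \<in> dir_limiting_coderivative (limiting_normal_cone D)
                         (g x, l) (J x *v u, \<eta>) (J x *v ws)})" if ND for us ws
    proof
      fix zs assume "zs \<in> dir_limiting_coderivative (limiting_normal_cone \<Gamma>) (x, xs) (u, us) ws"
      from dir_limiting_coderivative_subset[OF eb _ this] that
      show "zs \<in> (\<Union>l \<in> \<Lambda> (x, xs). \<Union>\<eta> \<in> graphical_derivative \<Lambda> ((x, xs), l) (u, us).
                  {H l x *v ws + transpose (J x) *v \<zeta> | \<zeta>.
                   \<zeta> \<in> dir_limiting_coderivative (limiting_normal_cone D)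
                         (g x, l) (J x *v u, \<eta>) (J x *v ws)})"
        unfolding ND_def by blast
    qed
    show "let DN = graphical_derivative (limiting_normal_cone \<Gamma>) (x, xs) u;
         R = (\<Union>l \<in> \<Lambda> (x, xs). {H l x *v u + transpose (J x) *v \<mu> | \<mu>.
                \<mu> \<in> limiting_normal_cone (critical_cone D (g x) l) (J x *v u)});
         SR = (\<forall>l \<in> \<Lambda> (x, xs). \<forall>\<eta> \<in> limiting_normal_cone (critical_cone D (g x) l) (J x *v u).
                dir_metrically_subregular F (x, l) (0, 0) (u, \<eta>));
         ND = (\<forall>\<mu>. transpose (J x) *v \<mu> = 0 \<longrightarrow>
                \<mu> \<in> span (limiting_normal_cone (tangent_cone D (g x)) (J x *v u)) \<longrightarrow> \<mu> = 0)
     in DN \<subseteq> R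
        \<and> R = (\<Union>l \<in> \<Lambda> (x, xs). {H l x *v u + \<nu> | \<nu>.
                \<nu> \<in> limiting_normal_cone (critical_cone \<Gamma> x xs) u})
        \<and> (SR \<longrightarrow> R \<subseteq> DN)
        \<and> (ND \<longrightarrow> SR \<and> R \<subseteq> DN)
        \<and> (ND \<longrightarrow> (\<forall>ws. \<forall>us \<in> DN.
             dir_limiting_coderivative (limiting_normal_cone \<Gamma>) (x, xs) (u, us) ws
             \<subseteq> (\<Union>l \<in> \<Lambda> (x, xs). \<Union>\<eta> \<in> graphical_derivative \<Lambda> ((x, xs), l) (u, us).
                  {H l x *v ws + transpose (J x) *v \<zeta> | \<zeta>.
                   \<zeta> \<in> dir_limiting_coderivative (limiting_normal_cone D)
                         (g x, l) (J x *v u, \<eta>) (J x *v ws)})))"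
      unfolding Let_def DN_def[symmetric] R_def[symmetric] SR_def[symmetric] ND_def[symmetric]
      by (intro conjI impI allI ballI 1 2) (erule 3 4 5 3[OF 4])+
  qed
qed

end
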